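(* Let $N\ge 11$ and let $f$ satisfy the standing assumptions given in the context. Assume that there exist constants $q_1\le q_2$ and $0<\ell\le\infty$ satisfying $1\le q_1\le q_{JL}$, $$q_1\le f'(u)F(u)\le q_2\quad\text{for } 0<u<\ell,$$ and $$q_2(2N-4q_1)\le\frac{(N-2)^2}{4}.$$ Then $u(r,\alpha)$ is stable for $0<\alpha<\ell$. Furthermore, if the inequalities $q_1\le f'(u)F(u)\le q_2$ hold with $\ell=\infty$, that is, for all $u>0$, then $u(r,\alpha)$ is stable for every $\alpha>0$, and $u(r,\alpha)$ is strictly increasing in $\alpha>0$ for each fixed $r>0$.
   Context: Standing assumptions on $f:\mathbb{R}\to\mathbb{R}$: $f\in C^2(\mathbb{R}\setminus\{0\})\cap C^1(\mathbb{R})$; $f$ is odd (so $f(0)=0$); and for all $u>0$, $f(u)>0$, $f'(u)>0$, $f''(u)>0$ and $F(u):=\int_u^\infty \frac{ds}{f(s)}<\infty$. $q_{JL}:=\frac{N-2\sqrt{N-1}}{4}$. For $\alpha>0$, $u(r,\alpha)$ denotes the unique solution of $u''+\frac{N-1}{r}u'+f(u)=0$ for $r>0$, $u(0)=\alpha$, $u'(0)=0$. A solution $u\in C^2(\mathbb{R}^N)$ of $\Delta u+f(u)=0$ in $\mathbb{R}^N$ is called stable if $\int_{\mathbb{R}^N}(|\nabla\phi|^2-f'(u)\phi^2)\,dx\ge 0$ for every $\phi\in C^1_0(\mathbb{R}^N)$ ($C^1$ functions with compact support). We say $u(r,\alpha)$ is stable if $x\mapsto u(|x|,\alpha)$ is.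 *)

theory Defs
  imports "HOL-Analysis.Analysis"
begin

definition tail_integral :: "(real \<Rightarrow> real) \<Rightarrow> real \<Rightarrow> real" where
  "tail_integral f u = (LINT s:{u<..}|lborel. 1 / f s)"

definition standing_assumptions :: "(real \<Rightarrow> real) \<Rightarrow> bool" where
  "standing_assumptions f \<longleftrightarrow>
     f differentiable_on UNIV \<and> continuous_on UNIV (deriv f) \<and>
     deriv f differentiable_on (- {0}) \<and> continuous_on (- {0}) (deriv (deriv f)) \<and>
     (\<forall>x. f (- x) = - f x) \<and>
     (\<forall>u>0. f u > 0 \<and> deriv f u > 0 \<and> deriv (deriv f) u > 0 \<and>
            set_integrable lborel {u<..} (\<lambda>s. 1 / f s))"

definition q_JL :: "nat \<Rightarrow> real" where
  "q_JL N = (real N - 2 * sqrt (real N - 1)) / 4"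

text \<open>The profile lives on the half-line, so the initial slope is a one-sided derivative;
  the values of \<open>u\<close> at negative arguments are irrelevant.\<close>

definition radial_solution :: "nat \<Rightarrow> (real \<Rightarrow> real) \<Rightarrow> real \<Rightarrow> (real \<Rightarrow> real) \<Rightarrow> bool" where
  "radial_solution N f \<alpha> u \<longleftrightarrow>
     u 0 = \<alpha> \<and> (u has_real_derivative 0) (at 0 within {0..}) \<and>
     (\<forall>r>0. u differentiable (at r) \<and> deriv u differentiable (at r) \<and>
            deriv (deriv u) r + (real N - 1) / r * deriv u r + f (u r) = 0)"

definition grad :: "('a::euclidean_space \<Rightarrow> real) \<Rightarrow> 'a \<Rightarrow> 'a" where
  "grad v x = (\<Sum>b\<in>Basis. frechet_derivative v (at x) b *\<^sub>R b)"

definition laplacian :: "('a::euclidean_space \<Rightarrow> real) \<Rightarrow> 'a \<Rightarrow> real" where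
  "laplacian v x = (\<Sum>b\<in>Basis. grad (\<lambda>y. grad v y \<bullet> b) x \<bullet> b)"

definition C1 :: "('a::euclidean_space \<Rightarrow> real) \<Rightarrow> bool" where
  "C1 v \<longleftrightarrow> v differentiable_on UNIV \<and> continuous_on UNIV (grad v)"

definition C2 :: "('a::euclidean_space \<Rightarrow> real) \<Rightarrow> bool" where
  "C2 v \<longleftrightarrow> C1 v \<and> (\<forall>b\<in>Basis. C1 (\<lambda>x. grad v x \<bullet> b))"

definition entire_solution :: "(real \<Rightarrow> real) \<Rightarrow> ('a::euclidean_space \<Rightarrow> real) \<Rightarrow> bool" where
  "entire_solution f v \<longleftrightarrow> C2 v \<and> (\<forall>x. laplacian v x + f (v x) = 0)"

definition stable_solution :: "(real \<Rightarrow> real) \<Rightarrow> ('a::euclidean_space \<Rightarrow> real) \<Rightarrow> bool" where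
  "stable_solution f v \<longleftrightarrow> entire_solution f v \<and>
     (\<forall>\<phi>. C1 \<phi> \<and> compact (closure {x. \<phi> x \<noteq> 0}) \<longrightarrow>
        (LINT x|lborel. (norm (grad \<phi> x))\<^sup>2 - deriv f (v x) * (\<phi> x)\<^sup>2) \<ge> 0)"

end

theory Submission
  imports Defs
begin

text \<open>
  Let \<open>F = tail_integral f\<close> and \<open>w = F(u(r))\<close>. The equation becomes
  \<open>w'' + (N-1)/r w' = 1 + f'(u) F(u) w'\<^sup>2 / w \<ge> 1 + q1 (4 w' / r - 4 w / r\<^sup>2)\<close>, so that
  \<open>D = w - r\<^sup>2 / (2N - 4 q1)\<close> satisfies a linear Euler inequality
  \<open>r\<^sup>2 D'' + (\<mu>1 + \<mu>2 + 1) r D' + \<mu>1 \<mu>2 D \<ge> 0\<close> whose exponents are real and positive exactly because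
  \<open>q1 \<le> q_JL N\<close>; factoring the operator gives \<open>D \<ge> 0\<close>. Hence
  \<open>f'(u) \<le> q2 / w \<le> (N-2)\<^sup>2 / (4 r\<^sup>2)\<close>, which is stability by Hardy's inequality. By convexity of \<open>f\<close>
  the same bound puts \<open>u\<close>, and the difference of two solutions, under the Euler inequality with the
  double exponent \<open>(N-2)/2\<close>, so neither can reach zero: solutions stay positive and ordered.
\<close>

section \<open>Euler differential inequalities\<close>

text \<open>Working with the right limit at 0 avoids any condition on the value of \<open>g\<close>
  at 0, where the functions to come need not be differentiable.\<close>

lemma nondecreasing_limit_lower_bound:
  fixes g :: "real \<Rightarrow> real"
  assumes der: "\<And>r. 0 < r \<Longrightarrow> r < R \<Longrightarrow> \<exists>y. (g has_real_derivative y) (at r) \<and> 0 \<le> y"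
    and lim: "(g \<longlongrightarrow> L) (at_right 0)"
    and r: "0 < r" "r < R"
  shows "L \<le> g r"
proof (rule tendsto_upperbound[OF lim])
  show "\<forall>\<^sub>F x in at_right 0. g x \<le> g r"
    using eventually_at_right_real[OF r(1)]
  proof eventually_elim
    case (elim x)
    then show ?case
      using r der by (intro DERIV_nonneg_imp_nondecreasing[of x r g]) auto
  qed
qed simp

text \<open>The operator factors. With \<open>E = \<mu>2 * D + r * D1\<close>, the derivative of
  \<open>r powr \<mu>1 * E\<close> is \<open>r powr (\<mu>1 - 1)\<close> times the Euler expression,
  hence nonnegative. This product tends to 0 at the origin because \<mu>1 is positive, so
  \<open>E\<close> is nonnegative, and \<open>E\<close> has the sign of the derivative of
  \<open>r powr \<mu>2 * D\<close>. The sign of \<mu>2 is left free.\<close>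

lemma euler_inequality_weighted_mono:
  fixes D D1 D2 :: "real \<Rightarrow> real"
  assumes D: "\<And>r. 0 < r \<Longrightarrow> r < R \<Longrightarrow> (D has_real_derivative D1 r) (at r)"
    and D1: "\<And>r. 0 < r \<Longrightarrow> r < R \<Longrightarrow> (D1 has_real_derivative D2 r) (at r)"
    and ineq: "\<And>r. 0 < r \<Longrightarrow> r < R \<Longrightarrow>
          0 \<le> r\<^sup>2 * D2 r + (\<mu>1 + \<mu>2 + 1) * r * D1 r + \<mu>1 * \<mu>2 * D r"
    and mu1: "0 < \<mu>1"
    and lim0: "(D \<longlongrightarrow> d) (at_right 0)"
    and lim1: "((\<lambda>r. r * D1 r) \<longlongrightarrow> 0) (at_right 0)"
    and rs: "0 < r" "r \<le> s" "s < R"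
  shows "r powr \<mu>2 * D r \<le> s powr \<mu>2 * D s"
proof -
  define g where "g = (\<lambda>r. r powr \<mu>1 * (\<mu>2 * D r + r * D1 r))"
  have "((\<lambda>r. r powr \<mu>1) \<longlongrightarrow> 0 powr \<mu>1) (at_right 0)"
    using mu1 by (intro tendsto_powr2 tendsto_intros) (auto simp: eventually_at_filter)
  then have "(g \<longlongrightarrow> 0 powr \<mu>1 * (\<mu>2 * d + 0)) (at_right 0)"
    unfolding g_def by (intro tendsto_mult tendsto_add tendsto_const lim0 lim1)
  then have glim: "(g \<longlongrightarrow> 0) (at_right 0)"
    by simp
  have g_der: "\<exists>y. (g has_real_derivative y) (at r) \<and> 0 \<le> y" if r: "0 < r" "r < R" for r
  proof (intro exI conjI)
    let ?y = "r powr (\<mu>1 - 1) * (r\<^sup>2 * D2 r + (\<mu>1 + \<mu>2 + 1) * r * D1 r + \<mu>1 * \<mu>2 * D r)"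
    have e: "r powr \<mu>1 = r powr (\<mu>1 - 1) * r"
      using r by (simp add: powr_diff)
    show "(g has_real_derivative ?y) (at r)"
      unfolding g_def
      by (rule derivative_eq_intros has_real_derivative_powr D[OF r] D1[OF r] r refl)+
        (simp add: e algebra_simps power2_eq_square)
    show "0 \<le> ?y"
      using ineq[OF r] by simp
  qed
  have g_nonneg: "0 \<le> g r" if "0 < r" "r < R" for r
    using nondecreasing_limit_lower_bound[OF g_der glim that] .
  show ?thesis
  proof (rule DERIV_nonneg_imp_nondecreasing[OF rs(2), of "\<lambda>r. r powr \<mu>2 * D r"])
    fix x assume "r \<le> x" "x \<le> s"
    then have x: "0 < x" "x < R"
      using rs by auto
    have e: "x powr (\<mu>2 - 1) = x powr \<mu>2 / x"
      using x by (simp add: powr_diff)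
    have "((\<lambda>r. r powr \<mu>2 * D r) has_real_derivative x powr (\<mu>2 - 1) * (\<mu>2 * D x + x * D1 x)) (at x)"
      by (rule derivative_eq_intros has_real_derivative_powr D[OF x] x refl)+
        (use x in \<open>simp add: e field_simps\<close>)
    moreover have "0 \<le> \<mu>2 * D x + x * D1 x"
      using g_nonneg[OF x] x by (simp add: g_def zero_le_mult_iff)
    ultimately show "\<exists>y. ((\<lambda>r. r powr \<mu>2 * D r) has_real_derivative y) (at x) \<and> 0 \<le> y"
      by force
  qed
qed

text \<open>For positive \<mu>2 the nondecreasing function \<open>r powr \<mu>2 * D r\<close> also
  starts from 0 at the origin, whatever the limit \<open>d\<close> of \<open>D\<close> is.\<close>

lemma euler_inequality_nonneg:
  fixes D D1 D2 :: "real \<Rightarrow> real"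
  assumes D: "\<And>r. 0 < r \<Longrightarrow> r < R \<Longrightarrow> (D has_real_derivative D1 r) (at r)"
    and D1: "\<And>r. 0 < r \<Longrightarrow> r < R \<Longrightarrow> (D1 has_real_derivative D2 r) (at r)"
    and ineq: "\<And>r. 0 < r \<Longrightarrow> r < R \<Longrightarrow>
          0 \<le> r\<^sup>2 * D2 r + (\<mu>1 + \<mu>2 + 1) * r * D1 r + \<mu>1 * \<mu>2 * D r"
    and mu: "0 < \<mu>1" "0 < \<mu>2"
    and lim0: "(D \<longlongrightarrow> d) (at_right 0)"
    and lim1: "((\<lambda>r. r * D1 r) \<longlongrightarrow> 0) (at_right 0)"
    and r: "0 < r" "r < R"
  shows "0 \<le> D r"
proof -
  have "((\<lambda>r. r powr \<mu>2) \<longlongrightarrow> 0 powr \<mu>2) (at_right 0)"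
    using mu by (intro tendsto_powr2 tendsto_intros) (auto simp: eventually_at_filter)
  then have "((\<lambda>r. r powr \<mu>2 * D r) \<longlongrightarrow> 0 powr \<mu>2 * d) (at_right 0)"
    by (intro tendsto_mult lim0)
  then have lim: "((\<lambda>r. r powr \<mu>2 * D r) \<longlongrightarrow> 0) (at_right 0)"
    by simp
  have "0 \<le> r powr \<mu>2 * D r"
  proof (rule tendsto_upperbound[OF lim])
    show "\<forall>\<^sub>F x in at_right 0. x powr \<mu>2 * D x \<le> r powr \<mu>2 * D r"
      using eventually_at_right_real[OF r(1)]
    proof eventually_elim
      case (elim x)
      then show ?case
        using euler_inequality_weighted_mono[OF D D1 ineq mu(1) lim0 lim1, of R x r] r by auto
    qed
  qed simp
  then show ?thesis
    using r by (simp add: zero_le_mult_iff)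
qed

text \<open>In the applications the inequality is available only while \<open>D\<close> stays
  positive, so \<open>ineq\<close> is conditional. Up to the first failure \<open>R\<close> of
  positivity the weighted function is nondecreasing; its limit at \<open>R\<close> is therefore
  positive, and positivity continues past \<open>R\<close>.\<close>

lemma euler_inequality_pos:
  fixes D D1 D2 :: "real \<Rightarrow> real"
  assumes D: "\<And>r. 0 < r \<Longrightarrow> (D has_real_derivative D1 r) (at r)"
    and D1: "\<And>r. 0 < r \<Longrightarrow> (D1 has_real_derivative D2 r) (at r)"
    and ineq: "\<And>R r. 0 < r \<Longrightarrow> r < R \<Longrightarrow> (\<And>s. 0 \<le> s \<Longrightarrow> s < R \<Longrightarrow> 0 < D s) \<Longrightarrow>
          0 \<le> r\<^sup>2 * D2 r + (\<mu>1 + \<mu>2 + 1) * r * D1 r + \<mu>1 * \<mu>2 * D r"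
    and mu1: "0 < \<mu>1"
    and lim0: "(D \<longlongrightarrow> D 0) (at_right 0)"
    and lim1: "((\<lambda>r. r * D1 r) \<longlongrightarrow> 0) (at_right 0)"
    and D0: "0 < D 0"
    and r: "0 \<le> r"
  shows "0 < D r"
proof (rule ccontr)
  assume neg: "\<not> 0 < D r"
  define S where "S = {r. 0 \<le> r \<and> D r \<le> 0}"
  define R where "R = Inf S"
  have S: "S \<noteq> {}" "bdd_below S"
    using neg r by (auto simp: S_def bdd_below_def)
  have pos: "0 < D s" if "0 \<le> s" "s < R" for s
    using cInf_lower[OF _ S(2), of s] that by (force simp: S_def R_def)
  have "\<forall>\<^sub>F x in at_right 0. 0 < D x"
    using order_tendstoD(1)[OF lim0 D0] .
  then obtain b where b: "0 < b" "\<And>x. 0 < x \<Longrightarrow> x < b \<Longrightarrow> 0 < D x"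
    by (auto simp: eventually_at_right_field)
  have "b \<le> x" if "x \<in> S" for x
    using that b(2)[of x] D0 by (cases "x = 0") (auto simp: S_def not_less[symmetric])
  then have "b \<le> R"
    unfolding R_def using S(1) by (intro cInf_greatest)
  with b(1) have R: "0 < R" by simp
  have contR: "isCont D R"
    using D[OF R] by (rule DERIV_isCont)
  have mono: "x powr \<mu>2 * D x \<le> y powr \<mu>2 * D y" if "0 < x" "x \<le> y" "y < R" for x y
    using that by (intro euler_inequality_weighted_mono[where D = D, OF D D1 ineq mu1 lim0 lim1] pos)
  have "((\<lambda>y. y powr \<mu>2 * D y) \<longlongrightarrow> R powr \<mu>2 * D R) (at_left R)"
    using R by (intro tendsto_intros tendsto_within_subset[OF contR[unfolded isCont_def]]) auto
  then have "(R/2) powr \<mu>2 * D (R/2) \<le> R powr \<mu>2 * D R"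
  proof (rule tendsto_lowerbound)
    show "\<forall>\<^sub>F y in at_left R. (R / 2) powr \<mu>2 * D (R / 2) \<le> y powr \<mu>2 * D y"
      using eventually_at_left_real[of "R/2" R] R
      by (auto elim!: eventually_mono intro!: mono)
  qed simp
  moreover have "0 < (R/2) powr \<mu>2 * D (R/2)"
    using R pos[of "R/2"] by simp
  ultimately have "0 < R powr \<mu>2 * D R"
    by linarith
  then have "0 < D R"
    using R by (simp add: zero_less_mult_iff)
  then have "\<forall>\<^sub>F x in at R. 0 < D x"
    using contR[unfolded isCont_def] order_tendstoD(1) by blast
  then obtain e where e: "0 < e" "\<And>x. x \<noteq> R \<Longrightarrow> dist x R < e \<Longrightarrow> 0 < D x"
    by (auto simp: eventually_at)
  \<comment> \<open>Neither points below \<open>R\<close> nor points within \<open>e\<close> of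
    \<open>R\<close> lie in \<open>S\<close>, so the infimum \<open>R\<close> would be at least
    \<open>R + e\<close>.\<close>
  have "R + e \<le> x" if "x \<in> S" for x
  proof (rule ccontr)
    assume "\<not> R + e \<le> x"
    moreover have "R \<le> x"
      unfolding R_def using that S(2) by (rule cInf_lower)
    ultimately have "0 < D x"
      using e(2)[of x] \<open>0 < D R\<close> by (cases "x = R") (auto simp: dist_real_def)
    with that show False by (simp add: S_def)
  qed
  then have "R + e \<le> R"
    unfolding R_def using S(1) by (intro cInf_greatest) (auto simp: R_def)
  with e(1) show False by simp
qed

section \<open>The radial equation\<close>

lemma standing_assumptionsD:
  assumes "standing_assumptions f"
  shows standing_DERIV: "(f has_real_derivative deriv f x) (at x)"
    and standing_continuous_deriv: "continuous_on UNIV (deriv f)"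
    and standing_DERIV2: "x \<noteq> 0 \<Longrightarrow> (deriv f has_real_derivative deriv (deriv f) x) (at x)"
    and standing_odd: "f (- x) = - f x"
    and standing_pos: "0 < x \<Longrightarrow> 0 < f x"
    and standing_deriv_pos: "0 < x \<Longrightarrow> 0 < deriv f x"
    and standing_deriv2_pos: "0 < x \<Longrightarrow> 0 < deriv (deriv f) x"
    and standing_integrable: "0 < x \<Longrightarrow> set_integrable lborel {x<..} (\<lambda>s. 1 / f s)"
proof -
  show "(f has_real_derivative deriv f x) (at x)"
    using assms unfolding standing_assumptions_def
    by (auto simp: differentiable_on_def DERIV_deriv_iff_real_differentiable)
  show "(deriv f has_real_derivative deriv (deriv f) x) (at x)" if "x \<noteq> 0"
  proof -
    have "at x within - {0} = at x"
      using that by (intro at_within_open) auto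
    then have "deriv f differentiable (at x)"
      using assms that unfolding standing_assumptions_def differentiable_on_def
      by (metis ComplI singletonD)
    then show ?thesis
      by (simp add: DERIV_deriv_iff_real_differentiable)
  qed
qed (use assms in \<open>auto simp: standing_assumptions_def\<close>)

lemma standing_isCont:
  assumes "standing_assumptions f"
  shows "isCont f x"
  using standing_DERIV[OF assms] by (rule DERIV_isCont)

text \<open>The mean value point lies strictly to the right of \<open>a\<close>, so the monotonicity
  of \<open>deriv f\<close> is invoked only at positive points, where the second derivative exists.
  This permits \<open>a = 0\<close>, the case that yields
  \<open>f u \<le> deriv f u * u\<close>.\<close>

lemma standing_convex:
  assumes f: "standing_assumptions f" and ab: "0 \<le> a" "a < b"
  shows "f b - f a \<le> deriv f b * (b - a)"
proof -
  obtain z where z: "a < z" "z < b" "f b - f a = (b - a) * deriv f z"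
    using MVT2[OF ab(2), of f "deriv f"] standing_DERIV[OF f] by blast
  have "deriv f z \<le> deriv f b"
  proof (rule DERIV_nonneg_imp_nondecreasing[of z b "deriv f"])
    fix x assume "z \<le> x" "x \<le> b"
    then have "0 < x"
      using z ab by linarith
    then show "\<exists>y. (deriv f has_real_derivative y) (at x) \<and> 0 \<le> y"
      using standing_DERIV2[OF f, of x] standing_deriv2_pos[OF f, of x] by (auto intro: less_imp_le)
  qed (use z in simp)
  then show ?thesis
    using z ab by (simp add: mult.commute mult_right_mono)
qed

text \<open>Cutting the tail at a fixed \<open>a\<close> below \<open>x\<close> turns it, near
  \<open>x\<close>, into a constant minus the integral of a continuous function over a compact
  interval, to which the fundamental theorem of calculus applies.\<close>

lemma DERIV_tail_integral:
  assumes f: "standing_assumptions f" and x: "0 < x"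
  shows "(tail_integral f has_real_derivative - (1 / f x)) (at x)"
proof -
  define a where "a = x / 2"
  define b where "b = 2 * x"
  have ab: "0 < a" "a < x" "x < b"
    using x by (auto simp: a_def b_def)
  have cont: "continuous_on {a..b} (\<lambda>s. 1 / f s)"
  proof (intro continuous_intros continuous_at_imp_continuous_on ballI standing_isCont[OF f])
    show "f s \<noteq> 0" if "s \<in> {a..b}" for s
      using that ab standing_pos[OF f, of s] by auto
  qed
  have split: "tail_integral f y = tail_integral f a - integral {a..y} (\<lambda>s. 1 / f s)"
    if y: "a < y" "y < b" for y
  proof -
    have un: "{a<..} = {a<..y} \<union> {y<..}"
      using y by auto
    have "continuous_on {a..y} (\<lambda>s. 1 / f s)"
      using cont y by (auto intro: continuous_on_subset)
    then have int': "set_integrable lborel {a..y} (\<lambda>s. 1 / f s)"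
      by (rule borel_integrable_atLeastAtMost')
    then have int: "set_integrable lborel {a<..y} (\<lambda>s. 1 / f s)"
      by (rule set_integrable_subset) auto
    have "tail_integral f a = (LINT s:{a<..y} \<union> {y<..}|lborel. 1 / f s)"
      unfolding tail_integral_def un ..
    also have "\<dots> = (LINT s:{a<..y}|lborel. 1 / f s) + tail_integral f y"
      unfolding tail_integral_def
      using int standing_integrable[OF f, of y] ab y by (intro set_integral_Un) auto
    also have "(LINT s:{a<..y}|lborel. 1 / f s) = integral {a<..y} (\<lambda>s. 1 / f s)"
      using int by (rule set_borel_integral_eq_integral)
    also have "\<dots> = integral {a..y} (\<lambda>s. 1 / f s)"
      by (rule integral_spike_set) (auto intro: negligible_subset[of "{a}"])
    finally show ?thesis by simp
  qed
  have "((\<lambda>y. tail_integral f a - integral {a..y} (\<lambda>s. 1 / f s)) has_real_derivative 0 - 1 / f x)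
      (at x within {a<..<b})"
    using ab
    by (intro derivative_intros DERIV_subset[OF integral_has_real_derivative[OF cont]]) auto
  then have "((\<lambda>y. tail_integral f a - integral {a..y} (\<lambda>s. 1 / f s)) has_real_derivative - (1 / f x)) (at x)"
    using ab by (simp add: at_within_open[of x "{a<..<b}"])
  then show ?thesis
    by (rule has_field_derivative_transform_within_open[of _ _ _ "{a<..<b}"]) (use ab split in auto)
qed

text \<open>Strictness comes from the derivative: the tail integral strictly decreases from
  \<open>x\<close> to \<open>x + 1\<close>, where it is still nonnegative.\<close>

lemma tail_integral_pos:
  assumes f: "standing_assumptions f" and x: "0 < x"
  shows "0 < tail_integral f x"
proof -
  have "tail_integral f (x + 1) < tail_integral f x"
  proof (rule DERIV_neg_imp_decreasing[of x "x + 1" "tail_integral f"])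
    fix y assume "x \<le> y" "y \<le> x + 1"
    then show "\<exists>d. (tail_integral f has_real_derivative d) (at y) \<and> d < 0"
      using DERIV_tail_integral[OF f, of y] standing_pos[OF f, of y] x by force
  qed simp
  moreover have "0 \<le> tail_integral f (x + 1)"
    unfolding tail_integral_def set_lebesgue_integral_def
    using standing_pos[OF f] x
    by (intro Bochner_Integration.integral_nonneg) (auto simp: indicator_def intro: less_imp_le)
  ultimately show ?thesis by linarith
qed

section \<open>Radial solutions: behaviour at the origin, a priori bounds, positivity and
  ordering\<close>

lemma radial_solutionD:
  assumes "radial_solution N f \<alpha> u"
  shows radial_solution_0: "u 0 = \<alpha>"
    and radial_solution_DERIV: "0 < r \<Longrightarrow> (u has_real_derivative deriv u r) (at r)"
    and radial_solution_DERIV2: "0 < r \<Longrightarrow> (deriv u has_real_derivative deriv (deriv u) r) (at r)"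
    and radial_solution_ode: "0 < r \<Longrightarrow>
      deriv (deriv u) r = - (real N - 1) / r * deriv u r - f (u r)"
    and radial_solution_tendsto_0: "(u \<longlongrightarrow> \<alpha>) (at_right 0)"
    and radial_solution_quotient: "((\<lambda>r. (u r - \<alpha>) / r) \<longlongrightarrow> 0) (at_right 0)"
proof -
  have 0: "(u has_real_derivative 0) (at 0 within {0..})" and u0: "u 0 = \<alpha>"
    using assms by (auto simp: radial_solution_def)
  then have "(u has_real_derivative 0) (at_right 0)"
    by (auto intro: DERIV_subset)
  then show "((\<lambda>r. (u r - \<alpha>) / r) \<longlongrightarrow> 0) (at_right 0)"
    using u0 by (simp add: has_field_derivative_iff)
  have "continuous (at_right 0) u"
    using \<open>(u has_real_derivative 0) (at_right 0)\<close> by (rule DERIV_continuous)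
  then show "(u \<longlongrightarrow> \<alpha>) (at_right 0)"
    using u0 by (simp add: continuous_within)
next
  assume "0 < r"
  then have "deriv (deriv u) r + (real N - 1) / r * deriv u r + f (u r) = 0"
    using assms by (auto simp: radial_solution_def)
  then show "deriv (deriv u) r = - (real N - 1) / r * deriv u r - f (u r)"
    by linarith
qed (use assms in \<open>auto simp: radial_solution_def DERIV_deriv_iff_real_differentiable\<close>)

text \<open>The function \<open>G\<close> below has derivative
  \<open>r ^ (N - 1) * (f \<alpha> - f (u r))\<close>, which is small compared with
  \<open>r ^ (N - 1)\<close>. Once \<open>G\<close> is known to be arbitrarily small at points near
  0, integration makes it small compared with \<open>r ^ N\<close>, and dividing by
  \<open>r ^ N\<close> gives the limit.\<close>

lemma radial_solution_slope:
  assumes u: "radial_solution N f \<alpha> u" and f: "isCont f \<alpha>" and N: "0 < N"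
  shows "((\<lambda>r. deriv u r / r) \<longlongrightarrow> - f \<alpha> / real N) (at_right 0)"
proof -
  obtain n where n: "N = Suc n"
    using N gr0_conv_Suc by auto
  define G where "G = (\<lambda>r. r ^ n * deriv u r + r ^ Suc n * (f \<alpha> / real N))"
  have G: "(G has_real_derivative r ^ n * (f \<alpha> - f (u r))) (at r)" if r: "0 < r" for r
  proof -
    \<comment> \<open>For \<open>n = 0\<close> the exponent is truncated to 0, but the factor
      \<open>n\<close> makes both sides vanish.\<close>
    have rn: "real n * r ^ (n - 1) = real n * r ^ n / r"
      using r by (cases n) auto
    have "(G has_real_derivative
       (real n * r ^ (n - 1) * deriv u r + r ^ n * deriv (deriv u) r + real N * r ^ n * (f \<alpha> / real N))) (at r)"
      unfolding G_def
      by (rule derivative_eq_intros refl radial_solution_DERIV2[OF u r] | simp add: n)+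
    also have "real n * r ^ (n - 1) * deriv u r + r ^ n * deriv (deriv u) r + real N * r ^ n * (f \<alpha> / real N)
        = r ^ n * (f \<alpha> - f (u r))"
      unfolding rn radial_solution_ode[OF u r] using r N
      by (simp add: field_simps) (simp add: n algebra_simps)
    finally show ?thesis .
  qed
  \<comment> \<open>No limit of \<open>deriv u\<close> at 0 is available yet. The one-sided
    derivative at 0 and the mean value theorem supply points arbitrarily close to 0 with small
    slope, which is enough to anchor \<open>G\<close>.\<close>
  have small: "\<exists>\<xi>. 0 < \<xi> \<and> \<xi> < e \<and> \<bar>deriv u \<xi>\<bar> < e" if e: "0 < e" for e
  proof -
    have "\<forall>\<^sub>F x in at_right 0. \<bar>(u x - \<alpha>) / x\<bar> < e \<and> x \<in> {0<..<e}"
      using radial_solution_quotient[OF u] e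
      by (intro eventually_conj eventually_at_right_real) (auto simp: tendsto_iff dist_real_def)
    then obtain x where x: "\<bar>(u x - \<alpha>) / x\<bar> < e" "0 < x" "x < e"
      by (auto dest: eventually_happens)
    have "continuous_on {0..x} u"
      unfolding continuous_on_eq_continuous_within
    proof
      fix y assume "y \<in> {0..x}"
      then consider "y = 0" | "0 < y" by force
      then show "continuous (at y within {0..x}) u"
      proof cases
        case 1
        have "(u has_real_derivative 0) (at 0 within {0..x})"
          using u by (auto simp: radial_solution_def intro: DERIV_subset)
        with 1 show ?thesis by (auto intro: DERIV_continuous)
      next
        case 2
        then show ?thesis
          using radial_solution_DERIV[OF u] DERIV_isCont continuous_at_imp_continuous_at_within by blast
      qed
    qed
    then obtain l z where z: "0 < z" "z < x" "(u has_real_derivative l) (at z)" "u x - u 0 = (x - 0) * l"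
      using MVT[of 0 x u] radial_solution_DERIV[OF u] x real_differentiable_def by blast
    have "l = deriv u z"
      using z(3) by (simp add: DERIV_imp_deriv)
    then have "(u x - \<alpha>) / x = deriv u z"
      using z(4) x radial_solution_0[OF u] by simp
    with x z show ?thesis by (intro exI[of _ z]) auto
  qed
  show ?thesis
    unfolding tendsto_iff
  proof (intro allI impI)
    fix \<epsilon> :: real assume "0 < \<epsilon>"
    then have e: "0 < \<epsilon> / 2" by simp
    have "((\<lambda>r. f (u r)) \<longlongrightarrow> f \<alpha>) (at_right 0)"
      using f radial_solution_tendsto_0[OF u] by (rule isCont_tendsto_compose)
    then have "\<forall>\<^sub>F r in at_right 0. \<bar>f (u r) - f \<alpha>\<bar> < \<epsilon> / 2"
      using e unfolding tendsto_iff dist_real_def by blast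
    then obtain \<delta> where d: "0 < \<delta>" "\<And>r. 0 < r \<Longrightarrow> r < \<delta> \<Longrightarrow> \<bar>f (u r) - f \<alpha>\<bar> < \<epsilon> / 2"
      by (auto simp: eventually_at_right_field)
    have bound: "\<bar>G r\<bar> \<le> \<epsilon> / 2 * r ^ Suc n" if r: "0 < r" "r < \<delta>" for r
    proof (rule field_le_epsilon)
      fix \<eta> :: real assume eta: "0 < \<eta>"
      \<comment> \<open>The bound by 1 gives \<open>\<xi> ^ n \<le> 1\<close>, so that
        \<open>\<bar>G \<xi>\<bar>\<close> is at most
        \<open>e * (1 + \<bar>f \<alpha>\<bar>)\<close>, hence at most \<eta>; the bound by
        \<open>r\<close> places \<xi> to the left of \<open>r\<close>.\<close>
      define e where "e = min (min r 1) (\<eta> / (1 + \<bar>f \<alpha>\<bar>))"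
      have e: "0 < e" "e \<le> r" "e \<le> 1" "e \<le> \<eta> / (1 + \<bar>f \<alpha>\<bar>)"
        using r eta by (auto simp: e_def)
      from small[OF e(1)] obtain \<xi> where xi: "0 < \<xi>" "\<xi> < e" "\<bar>deriv u \<xi>\<bar> < e"
        by blast
      have xin: "\<xi> ^ n \<le> 1"
        using xi e by (intro power_le_one) auto
      have "\<bar>G \<xi>\<bar> \<le> \<xi> ^ n * \<bar>deriv u \<xi>\<bar> + \<xi> ^ n * \<xi> * (\<bar>f \<alpha>\<bar> / real N)"
        unfolding G_def using xi by (intro order_trans[OF abs_triangle_ineq]) (auto simp: abs_mult mult_ac)
      also have "\<dots> \<le> 1 * e + 1 * e * (\<bar>f \<alpha>\<bar> / 1)"
        using xi xin e N by (intro add_mono mult_mono divide_left_mono) auto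
      also have "\<dots> = e * (1 + \<bar>f \<alpha>\<bar>)"
        by (simp add: algebra_simps)
      also have "\<dots> \<le> \<eta>"
        using e(4) by (simp add: field_simps pos_le_divide_eq add_pos_nonneg)
      finally have Gxi: "\<bar>G \<xi>\<bar> \<le> \<eta>" .
      have "\<xi> < r" using xi e by simp
      then obtain z where z: "\<xi> < z" "z < r" "G r - G \<xi> = (r - \<xi>) * (z ^ n * (f \<alpha> - f (u z)))"
        using MVT2[of \<xi> r G "\<lambda>r. r ^ n * (f \<alpha> - f (u r))"] G xi by force
      have "\<bar>G r - G \<xi>\<bar> = (r - \<xi>) * (z ^ n * \<bar>f (u z) - f \<alpha>\<bar>)"
        using z xi by (simp add: abs_mult abs_minus_commute)
      also have "\<dots> \<le> r * (r ^ n * (\<epsilon> / 2))"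
        using z xi r d(2)[of z] by (intro mult_mono power_mono) auto
      finally have "\<bar>G r - G \<xi>\<bar> \<le> \<epsilon> / 2 * r ^ Suc n"
        by (simp add: mult_ac)
      with Gxi show "\<bar>G r\<bar> \<le> \<epsilon> / 2 * r ^ Suc n + \<eta>"
        by linarith
    qed
    have "\<bar>deriv u r / r - - f \<alpha> / real N\<bar> < \<epsilon>" if r: "0 < r" "r < \<delta>" for r
    proof -
      have "deriv u r / r - - f \<alpha> / real N = G r / r ^ Suc n"
        using r by (simp add: G_def field_simps)
      moreover have "\<bar>G r / r ^ Suc n\<bar> \<le> \<epsilon> / 2"
        using bound[OF r] r by (simp add: abs_mult divide_le_eq)
      ultimately show ?thesis
        using \<open>0 < \<epsilon>\<close> by linarith
    qed
    then show "\<forall>\<^sub>F r in at_right 0. dist (deriv u r / r) (- f \<alpha> / real N) < \<epsilon>"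
      using d(1) by (auto simp: eventually_at_right_field dist_real_def)
  qed
qed

lemma radial_solution_deriv_tendsto_0:
  assumes u: "radial_solution N f \<alpha> u" and f: "isCont f \<alpha>" and N: "0 < N"
  shows "(deriv u \<longlongrightarrow> 0) (at_right 0)"
proof -
  have "((\<lambda>r. deriv u r / r * r) \<longlongrightarrow> - f \<alpha> / real N * 0) (at_right 0)"
    by (intro tendsto_mult radial_solution_slope[OF assms] tendsto_ident_at)
  moreover have "\<forall>\<^sub>F r in at_right 0. deriv u r / r * r = deriv u r"
    by (auto simp: eventually_at_filter)
  ultimately have "(deriv u \<longlongrightarrow> - f \<alpha> / real N * 0) (at_right 0)"
    by (rule Lim_transform_eventually)
  then show ?thesis by simp
qed

text \<open>The flux \<open>r ^ (N - 1) * deriv u r\<close> vanishes at the origin and decreases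
  while \<open>f (u r)\<close> is positive, so \<open>u\<close> decreases there. This confines the
  values of \<open>u\<close> to the range where the bounds on the product of \<open>deriv f\<close>
  and \<open>tail_integral f\<close> are assumed.\<close>

lemma radial_solution_le_initial:
  assumes u: "radial_solution N f \<alpha> u" and f: "isCont f \<alpha>" and N: "1 < N"
    and pos: "\<And>r. 0 < r \<Longrightarrow> r < R \<Longrightarrow> 0 < f (u r)"
    and r: "0 < r" "r < R"
  shows "u r \<le> \<alpha>"
proof -
  obtain n where n: "N = Suc (Suc n)"
    using N by (auto dest!: less_imp_Suc_add)
  have "((\<lambda>r. - (r ^ Suc n * deriv u r)) \<longlongrightarrow> - (0 ^ Suc n * 0)) (at_right 0)"
    using N by (intro tendsto_intros radial_solution_deriv_tendsto_0[OF u f]) auto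
  then have lim: "((\<lambda>r. - (r ^ Suc n * deriv u r)) \<longlongrightarrow> 0) (at_right 0)"
    by simp
  have "0 \<le> - (r ^ Suc n * deriv u r)" if r: "0 < r" "r < R" for r
  proof (rule nondecreasing_limit_lower_bound[OF _ lim r])
    fix r assume r: "0 < r" "r < R"
    have "((\<lambda>r. - (r ^ Suc n * deriv u r)) has_real_derivative r ^ Suc n * f (u r)) (at r)"
      by (rule derivative_eq_intros radial_solution_DERIV2[OF u r(1)] refl)+
        (use r in \<open>simp add: radial_solution_ode[OF u r(1)] n field_simps\<close>)
    then show "\<exists>y. ((\<lambda>r. - (r ^ Suc n * deriv u r)) has_real_derivative y) (at r) \<and> 0 \<le> y"
      using pos[OF r] r by (intro exI[of _ "r ^ Suc n * f (u r)"]) auto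
  qed
  then have "r ^ Suc n * deriv u r \<le> 0" if "0 < r" "r < R" for r
    using that by fastforce
  then have neg: "deriv u r \<le> 0" if "0 < r" "r < R" for r
    using that zero_less_power[OF that(1), of "Suc n"] by (meson mult_pos_pos not_le)
  have "- \<alpha> \<le> - u r"
  proof (rule nondecreasing_limit_lower_bound[where g = "\<lambda>r. - u r", OF _ _ r])
    show "((\<lambda>r. - u r) \<longlongrightarrow> - \<alpha>) (at_right 0)"
      by (intro tendsto_minus radial_solution_tendsto_0[OF u])
    show "\<exists>y. ((\<lambda>r. - u r) has_real_derivative y) (at r) \<and> 0 \<le> y" if "0 < r" "r < R" for r
      using neg[OF that] radial_solution_DERIV[OF u that(1)]
      by (intro exI[of _ "- deriv u r"]) (auto intro: derivative_intros)
  qed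
  then show ?thesis by simp
qed

text \<open>With \<open>b = 2 * real N - 4 * q\<close>, the function \<open>r\<^sup>2 / b\<close>
  solves the equation for \<open>W\<close> exactly when the product of \<open>deriv f\<close> and
  \<open>tail_integral f\<close> is replaced by the constant \<open>q\<close>. Linearising the
  quadratic term along this solution makes \<open>b * W r - r\<^sup>2\<close> satisfy an Euler
  inequality.\<close>

lemma tail_integral_radial_lower_bound:
  assumes f: "standing_assumptions f" and u: "radial_solution N f \<alpha> u" and N: "2 < N"
    and alpha: "0 < \<alpha>"
    and q: "0 < q" "q \<le> q_JL N"
    and Q: "\<And>w. 0 < w \<Longrightarrow> w \<le> \<alpha> \<Longrightarrow> q \<le> deriv f w * tail_integral f w"
    and pos: "\<And>s. 0 \<le> s \<Longrightarrow> s < R \<Longrightarrow> 0 < u s"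
    and r: "0 < r" "r < R"
  shows "r\<^sup>2 \<le> (2 * real N - 4 * q) * tail_integral f (u r)"
proof -
  define s where "s = real N - 2 - 4 * q"
  define \<delta> where "\<delta> = sqrt (s\<^sup>2 - 16 * q)"
  define \<mu>1 where "\<mu>1 = (s + \<delta>) / 2"
  define \<mu>2 where "\<mu>2 = (s - \<delta>) / 2"
  have sqrtN: "1 < sqrt (real N - 1)"
    using N by simp
  have N4q: "2 * sqrt (real N - 1) \<le> real N - 4 * q"
    using q(2) by (simp add: q_JL_def)
  then have s: "0 < s"
    using sqrtN unfolding s_def by linarith
  \<comment> \<open>The discriminant \<open>s\<^sup>2 - 16 * q\<close> equals
    \<open>(N - 4 * q)\<^sup>2 - 4 * (N - 1)\<close>, so the condition \<open>q \<le> q_JL N\<close>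
    makes it nonnegative.\<close>
  have "(2 * sqrt (real N - 1))\<^sup>2 \<le> (real N - 4 * q)\<^sup>2"
    using N4q sqrtN by (intro power_mono) auto
  then have "4 * (real N - 1) \<le> (real N - 4 * q)\<^sup>2"
    using N by (simp add: power_mult_distrib)
  then have disc: "0 \<le> s\<^sup>2 - 16 * q"
    by (simp add: s_def power2_eq_square algebra_simps)
  have d: "0 \<le> \<delta>" "\<delta>\<^sup>2 = s\<^sup>2 - 16 * q"
    using disc by (auto simp: \<delta>_def)
  have "\<delta>\<^sup>2 < s\<^sup>2"
    using d(2) q(1) by simp
  then have "\<delta> < s"
    using s by (simp add: power2_less_imp_less)
  then have mu: "0 < \<mu>1" "0 < \<mu>2"
    using d(1) s by (auto simp: \<mu>1_def \<mu>2_def)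
  have mu_sum: "\<mu>1 + \<mu>2 = s"
    by (simp add: \<mu>1_def \<mu>2_def field_simps)
  have "\<mu>1 * \<mu>2 = (s\<^sup>2 - \<delta>\<^sup>2) / 4"
    by (simp add: \<mu>1_def \<mu>2_def power2_eq_square algebra_simps)
  then have mu_prod: "\<mu>1 * \<mu>2 = 4 * q"
    using d by simp
  define b where "b = 2 * real N - 4 * q"
  have b: "0 < b"
    using s N by (simp add: b_def s_def)
  define W where "W = (\<lambda>r. tail_integral f (u r))"
  define W1 where "W1 = (\<lambda>r. - (deriv u r / f (u r)))"
  define W2 where "W2 = (\<lambda>r. - ((deriv (deriv u) r * f (u r) - deriv u r * (deriv f (u r) * deriv u r)) / (f (u r) * f (u r))))"
  have W: "(W has_real_derivative W1 r) (at r)" if r: "0 < r" "r < R" for r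
  proof -
    have "(W has_real_derivative - (1 / f (u r)) * deriv u r) (at r)"
      unfolding W_def
      using r pos by (intro DERIV_chain2 DERIV_tail_integral[OF f] radial_solution_DERIV[OF u]) auto
    then show ?thesis by (simp add: W1_def)
  qed
  have W1: "(W1 has_real_derivative W2 r) (at r)" if r: "0 < r" "r < R" for r
  proof -
    have "f (u r) \<noteq> 0"
      using standing_pos[OF f pos, of r] r by simp
    then show ?thesis
      unfolding W1_def W2_def
      by (intro DERIV_minus DERIV_divide radial_solution_DERIV2[OF u] r
          DERIV_chain2[OF standing_DERIV[OF f]] radial_solution_DERIV[OF u])
  qed
  have le: "u r \<le> \<alpha>" if "0 < r" "r < R" for r
    using that N
    by (intro radial_solution_le_initial[OF u standing_isCont[OF f]] standing_pos[OF f] pos) auto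
  have ineq: "0 \<le> r\<^sup>2 * (b * W2 r - 2) + (\<mu>1 + \<mu>2 + 1) * r * (b * W1 r - 2 * r) + \<mu>1 * \<mu>2 * (b * W r - r\<^sup>2)"
    if r: "0 < r" "r < R" for r
  proof -
    have fpos: "0 < f (u r)"
      using standing_pos[OF f pos, of r] r by simp
    have Wpos: "0 < W r"
      unfolding W_def using tail_integral_pos[OF f pos, of r] r by simp
    have W2_eq: "W2 r = 1 - (real N - 1) / r * W1 r + deriv f (u r) * (W1 r)\<^sup>2"
      unfolding W2_def W1_def radial_solution_ode[OF u r(1)]
      using fpos r by (simp add: field_simps power2_eq_square)
    have r2W2: "r\<^sup>2 * W2 r = r\<^sup>2 - (real N - 1) * r * W1 r + deriv f (u r) * (r * W1 r)\<^sup>2"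
      unfolding W2_eq using r by (simp add: field_simps power2_eq_square)
    have "q / W r \<le> deriv f (u r)"
      using Q[of "u r"] pos[of r] le[OF r] r Wpos by (simp add: W_def pos_divide_le_eq)
    then have "q / W r * (r * W1 r)\<^sup>2 \<le> deriv f (u r) * (r * W1 r)\<^sup>2"
      by (rule mult_right_mono) simp
    \<comment> \<open>A square lies above its tangent line; the point of tangency
      \<open>r * W1 r = 2 * W r\<close> is the relation satisfied by multiples of
      \<open>r\<^sup>2\<close>.\<close>
    moreover have "q * (4 * (r * W1 r) - 4 * W r) \<le> q * ((r * W1 r)\<^sup>2 / W r)"
    proof (intro mult_left_mono)
      have "0 \<le> (r * W1 r - 2 * W r)\<^sup>2" by simp
      then show "4 * (r * W1 r) - 4 * W r \<le> (r * W1 r)\<^sup>2 / W r"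
        using Wpos by (simp add: field_simps power2_eq_square)
    qed (use q in simp)
    ultimately have "r\<^sup>2 - (real N - 1) * r * W1 r + q * (4 * (r * W1 r) - 4 * W r) \<le> r\<^sup>2 * W2 r"
      unfolding r2W2 by simp
    \<comment> \<open>The Euler operator maps \<open>r\<^sup>2\<close> to
      \<open>b * r\<^sup>2\<close>, so subtracting \<open>r\<^sup>2\<close> from
      \<open>b * W r\<close> absorbs the inhomogeneous term.\<close>
    then have "0 \<le> b * (r\<^sup>2 * W2 r - (r\<^sup>2 - (real N - 1) * r * W1 r + q * (4 * (r * W1 r) - 4 * W r)))"
      using b by (intro mult_nonneg_nonneg) auto
    also have "\<dots> = r\<^sup>2 * (b * W2 r - 2) + (\<mu>1 + \<mu>2 + 1) * r * (b * W1 r - 2 * r) + \<mu>1 * \<mu>2 * (b * W r - r\<^sup>2)"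
      unfolding mu_sum mu_prod by (simp add: s_def b_def power2_eq_square algebra_simps)
    finally show ?thesis .
  qed
  have "isCont (tail_integral f) \<alpha>"
    using DERIV_tail_integral[OF f alpha] by (rule DERIV_isCont)
  then have limW: "(W \<longlongrightarrow> tail_integral f \<alpha>) (at_right 0)"
    unfolding W_def by (rule isCont_tendsto_compose) (rule radial_solution_tendsto_0[OF u])
  have "((\<lambda>r. f (u r)) \<longlongrightarrow> f \<alpha>) (at_right 0)"
    by (rule isCont_tendsto_compose[OF standing_isCont[OF f] radial_solution_tendsto_0[OF u]])
  then have limW1: "(W1 \<longlongrightarrow> - (0 / f \<alpha>)) (at_right 0)"
    unfolding W1_def using standing_pos[OF f alpha] N
    by (intro tendsto_minus tendsto_divide radial_solution_deriv_tendsto_0[OF u standing_isCont[OF f]]) auto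
  have "0 \<le> b * W r - r\<^sup>2"
  proof (rule euler_inequality_nonneg[where D = "\<lambda>r. b * W r - r\<^sup>2" and ?D1.0 = "\<lambda>r. b * W1 r - 2 * r"
        and ?D2.0 = "\<lambda>r. b * W2 r - 2", OF _ _ ineq mu _ _ r])
    show "((\<lambda>r. b * W r - r\<^sup>2) has_real_derivative b * W1 r - 2 * r) (at r)" if "0 < r" "r < R" for r
      by (rule derivative_eq_intros W that refl)+ simp
    show "((\<lambda>r. b * W1 r - 2 * r) has_real_derivative b * W2 r - 2) (at r)" if "0 < r" "r < R" for r
      by (rule derivative_eq_intros W1 that refl)+ simp
    show "((\<lambda>r. b * W r - r\<^sup>2) \<longlongrightarrow> b * tail_integral f \<alpha> - 0\<^sup>2) (at_right 0)"
      by (intro tendsto_intros limW)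
    have "((\<lambda>r. r * (b * W1 r - 2 * r)) \<longlongrightarrow> 0 * (b * (- (0 / f \<alpha>)) - 2 * 0)) (at_right 0)"
      by (intro tendsto_mult tendsto_diff tendsto_const tendsto_ident_at limW1)
    then show "((\<lambda>r. r * (b * W1 r - 2 * r)) \<longlongrightarrow> 0) (at_right 0)"
      by simp
  qed
  then show ?thesis
    by (simp add: W_def b_def)
qed

text \<open>The right-hand side is the critical Hardy constant. Positivity, ordering and stability
  use the growth hypotheses only through this bound, which is stated up to \<open>R\<close> because
  positivity of \<open>u\<close> is not yet known globally.\<close>

lemma deriv_radial_upper_bound:
  assumes f: "standing_assumptions f" and u: "radial_solution N f \<alpha> u" and N: "2 < N"
    and alpha: "0 < \<alpha>"
    and q: "0 < q1" "q1 \<le> q_JL N"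
    and Q: "\<And>w. 0 < w \<Longrightarrow> w \<le> \<alpha> \<Longrightarrow>
       q1 \<le> deriv f w * tail_integral f w \<and> deriv f w * tail_integral f w \<le> q2"
    and q2: "q2 * (2 * real N - 4 * q1) \<le> (real N - 2)\<^sup>2 / 4"
    and pos: "\<And>s. 0 \<le> s \<Longrightarrow> s < R \<Longrightarrow> 0 < u s"
    and r: "0 < r" "r < R"
  shows "r\<^sup>2 * deriv f (u r) \<le> ((real N - 2) / 2)\<^sup>2"
proof -
  have ur: "0 < u r" "u r \<le> \<alpha>"
    using r N pos
    by (auto intro!: radial_solution_le_initial[OF u standing_isCont[OF f] _ _ r] standing_pos[OF f])
  have df: "0 < deriv f (u r)"
    using standing_deriv_pos[OF f ur(1)] .
  have "0 \<le> sqrt (real N - 1)" "4 * q1 \<le> real N - 2 * sqrt (real N - 1)"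
    using N q by (auto simp: q_JL_def)
  then have b: "0 < 2 * real N - 4 * q1"
    using N by linarith
  have "r\<^sup>2 * deriv f (u r) \<le> (2 * real N - 4 * q1) * tail_integral f (u r) * deriv f (u r)"
    using df Q by (intro mult_right_mono tail_integral_radial_lower_bound[OF f u N alpha q _ pos r]) auto
  also have "\<dots> = (deriv f (u r) * tail_integral f (u r)) * (2 * real N - 4 * q1)"
    by simp
  also have "\<dots> \<le> q2 * (2 * real N - 4 * q1)"
    using Q[OF ur] b by (intro mult_right_mono) auto
  also have "\<dots> \<le> ((real N - 2) / 2)\<^sup>2"
    using q2 by (simp add: power_divide)
  finally show ?thesis .
qed

text \<open>The bound presupposes positivity on an initial interval, and the first-zero argument
  breaks the circle. For \<open>k = (N - 2) / 2\<close>, the value \<open>2 * k + 1 = N - 1\<close>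
  matches the radial Laplacian, and \<open>k\<^sup>2\<close> is the largest zero-order coefficient
  for which the exponents are still real.\<close>

lemma radial_solution_pos:
  assumes f: "standing_assumptions f" and u: "radial_solution N f \<alpha> u" and N: "2 < N"
    and alpha: "0 < \<alpha>"
    and bound: "\<And>R r. (\<And>s. 0 \<le> s \<Longrightarrow> s < R \<Longrightarrow> 0 < u s) \<Longrightarrow> 0 < r \<Longrightarrow> r < R \<Longrightarrow>
        r\<^sup>2 * deriv f (u r) \<le> ((real N - 2) / 2)\<^sup>2"
    and r: "0 \<le> r"
  shows "0 < u r"
proof (rule euler_inequality_pos[where D = u and ?\<mu>1.0 = "(real N - 2) / 2" and ?\<mu>2.0 = "(real N - 2) / 2",
      OF radial_solution_DERIV[OF u] radial_solution_DERIV2[OF u] _ _ _ _ _ r])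
  show "(u \<longlongrightarrow> u 0) (at_right 0)" "0 < u 0" "0 < (real N - 2) / 2"
    using radial_solution_0[OF u] radial_solution_tendsto_0[OF u] alpha N by auto
  have "((\<lambda>r. r * deriv u r) \<longlongrightarrow> 0 * 0) (at_right 0)"
    using N by (intro tendsto_mult tendsto_ident_at radial_solution_deriv_tendsto_0[OF u standing_isCont[OF f]]) simp
  then show "((\<lambda>r. r * deriv u r) \<longlongrightarrow> 0) (at_right 0)"
    by simp
next
  fix R r assume r: "0 < r" "r < R" and pos: "\<And>s. 0 \<le> s \<Longrightarrow> s < R \<Longrightarrow> 0 < u s"
  have ur: "0 < u r" using pos r by simp
  have "f 0 = 0"
    using standing_odd[OF f, of 0] by simp
  then have "f (u r) \<le> deriv f (u r) * u r"
    using standing_convex[OF f _ ur] by simp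
  then have "r\<^sup>2 * f (u r) \<le> r\<^sup>2 * deriv f (u r) * u r"
    using r by (simp add: mult.assoc)
  also have "\<dots> \<le> ((real N - 2) / 2)\<^sup>2 * u r"
    using ur by (intro mult_right_mono bound[OF pos r]) auto
  finally have *: "r\<^sup>2 * f (u r) \<le> ((real N - 2) / 2)\<^sup>2 * u r" .
  have "r\<^sup>2 * deriv (deriv u) r + (real N - 1) * r * deriv u r = - (r\<^sup>2 * f (u r))"
    unfolding radial_solution_ode[OF u r(1)] using r by (simp add: field_simps power2_eq_square)
  moreover have sum: "(real N - 2) / 2 + (real N - 2) / 2 + 1 = real N - 1"
    by simp
  ultimately show "0 \<le> r\<^sup>2 * deriv (deriv u) r + ((real N - 2) / 2 + (real N - 2) / 2 + 1) * r * deriv u r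
      + (real N - 2) / 2 * ((real N - 2) / 2) * u r"
    unfolding sum power2_eq_square[of "(real N - 2) / 2", symmetric] using * by linarith
qed

text \<open>While \<open>v\<close> exceeds \<open>u\<close>, convexity bounds
  \<open>f (v r) - f (u r)\<close> through the slope at the upper value, so the Hardy bound is
  required for \<open>v\<close> alone. Positivity of \<open>u\<close> keeps both values in the range
  where \<open>f\<close> is convex.\<close>

lemma radial_solutions_ordered:
  assumes f: "standing_assumptions f" and N: "2 < N"
    and u: "radial_solution N f \<alpha> u" and v: "radial_solution N f \<beta> v"
    and less: "\<alpha> < \<beta>"
    and u_pos: "\<And>r. 0 \<le> r \<Longrightarrow> 0 < u r"
    and bound: "\<And>r. 0 < r \<Longrightarrow> r\<^sup>2 * deriv f (v r) \<le> ((real N - 2) / 2)\<^sup>2"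
    and r: "0 \<le> r"
  shows "u r < v r"
proof -
  let ?k = "(real N - 2) / 2"
  have "0 < v r - u r"
  proof (rule euler_inequality_pos[where D = "\<lambda>r. v r - u r" and ?D1.0 = "\<lambda>r. deriv v r - deriv u r"
        and ?D2.0 = "\<lambda>r. deriv (deriv v) r - deriv (deriv u) r"
        and ?\<mu>1.0 = ?k and ?\<mu>2.0 = ?k, OF _ _ _ _ _ _ _ r])
    show "((\<lambda>r. v r - u r) has_real_derivative deriv v r - deriv u r) (at r)"
      "((\<lambda>r. deriv v r - deriv u r) has_real_derivative deriv (deriv v) r - deriv (deriv u) r) (at r)"
      if "0 < r" for r
      using radial_solution_DERIV[OF u that] radial_solution_DERIV[OF v that]
        radial_solution_DERIV2[OF u that] radial_solution_DERIV2[OF v that]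
      by (auto intro: DERIV_diff)
    show "((\<lambda>r. v r - u r) \<longlongrightarrow> v 0 - u 0) (at_right 0)"
      unfolding radial_solution_0[OF u] radial_solution_0[OF v]
      by (intro tendsto_diff radial_solution_tendsto_0[OF u] radial_solution_tendsto_0[OF v])
    show "0 < v 0 - u 0" "0 < ?k"
      using less N radial_solution_0[OF u] radial_solution_0[OF v] by auto
    have "((\<lambda>r. r * (deriv v r - deriv u r)) \<longlongrightarrow> 0 * (0 - 0)) (at_right 0)"
      using N by (intro tendsto_mult tendsto_diff tendsto_ident_at
          radial_solution_deriv_tendsto_0[OF u standing_isCont[OF f]]
          radial_solution_deriv_tendsto_0[OF v standing_isCont[OF f]]) simp_all
    then show "((\<lambda>r. r * (deriv v r - deriv u r)) \<longlongrightarrow> 0) (at_right 0)"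
      by simp
  next
    fix R r assume r: "0 < r" "r < R" and pos: "\<And>s. 0 \<le> s \<Longrightarrow> s < R \<Longrightarrow> 0 < v s - u s"
    have uv: "0 \<le> u r" "u r < v r"
      using u_pos[of r] pos[of r] r by auto
    have "r\<^sup>2 * (f (v r) - f (u r)) \<le> r\<^sup>2 * deriv f (v r) * (v r - u r)"
      using standing_convex[OF f uv] r by (simp add: mult.assoc)
    also have "\<dots> \<le> ?k\<^sup>2 * (v r - u r)"
      using uv by (intro mult_right_mono bound r) auto
    finally have *: "r\<^sup>2 * (f (v r) - f (u r)) \<le> ?k\<^sup>2 * (v r - u r)" .
    have "r\<^sup>2 * (deriv (deriv v) r - deriv (deriv u) r)
        + (real N - 1) * r * (deriv v r - deriv u r) = - (r\<^sup>2 * (f (v r) - f (u r)))"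
      unfolding radial_solution_ode[OF u r(1)] radial_solution_ode[OF v r(1)]
      using r by (simp add: field_simps power2_eq_square)
    moreover have sum: "?k + ?k + 1 = real N - 1"
      by simp
    ultimately show "0 \<le> r\<^sup>2 * (deriv (deriv v) r - deriv (deriv u) r)
        + (?k + ?k + 1) * r * (deriv v r - deriv u r) + ?k * ?k * (v r - u r)"
      unfolding sum power2_eq_square[of ?k, symmetric] using * by linarith
  qed
  then show ?thesis by simp
qed

section \<open>Hardy's inequality\<close>

lemma grad_eqI:
  assumes "GDERIV v x :> D"
  shows "grad v x = D"
proof -
  have "frechet_derivative v (at x) = (\<lambda>h. h \<bullet> D)"
    using assms unfolding gderiv_def by (rule frechet_derivative_at[symmetric])
  then show ?thesis
    unfolding grad_def by (simp add: inner_commute[of _ D] euclidean_representation)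
qed

lemma GDERIV_grad:
  assumes "v differentiable (at x)"
  shows "GDERIV v x :> grad v x"
proof -
  have der: "(v has_derivative frechet_derivative v (at x)) (at x)"
    using assms frechet_derivative_works by blast
  have "frechet_derivative v (at x) h = h \<bullet> grad v x" for h
  proof -
    have "frechet_derivative v (at x) h = frechet_derivative v (at x) (\<Sum>b\<in>Basis. (h \<bullet> b) *\<^sub>R b)"
      by (simp add: euclidean_representation)
    also have "\<dots> = (\<Sum>b\<in>Basis. (h \<bullet> b) * frechet_derivative v (at x) b)"
      using has_derivative_linear[OF der] by (simp add: linear_sum linear_cmul)
    also have "\<dots> = h \<bullet> grad v x"
      by (simp add: grad_def inner_sum_right mult.commute)
    finally show ?thesis .
  qed
  then have "frechet_derivative v (at x) = (\<lambda>h. h \<bullet> grad v x)"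
    by blast
  with der show ?thesis
    by (simp add: gderiv_def)
qed

lemma C1_GDERIV:
  assumes "C1 v"
  shows "GDERIV v x :> grad v x"
  using assms by (auto simp: C1_def differentiable_on_def intro: GDERIV_grad)

lemma C1_continuous_on:
  assumes "C1 v"
  shows "continuous_on UNIV v"
  using assms by (auto simp: C1_def intro: differentiable_imp_continuous_on)

lemma C1I:
  assumes "\<And>x. GDERIV v x :> D x" and "continuous_on UNIV D"
  shows "C1 v"
proof -
  have "grad v = D"
    using grad_eqI[OF assms(1)] by blast
  then show ?thesis
    using assms by (auto simp: C1_def differentiable_on_def gderiv_def intro: differentiableI)
qed

lemma GDERIV_isCont:
  "GDERIV v x :> D \<Longrightarrow> isCont v x"
  unfolding gderiv_def by (rule has_derivative_continuous)

lemma GDERIV_inner_left: "GDERIV (\<lambda>x. x \<bullet> b) x :> b"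
  unfolding gderiv_def by (rule bounded_linear_imp_has_derivative[OF bounded_linear_inner_left])

section \<open>Integration of compactly supported functions and Hardy's inequality\<close>

lemma integrable_continuous_bounded_support:
  fixes g :: "'a::euclidean_space \<Rightarrow> real"
  assumes cont: "continuous_on UNIV g" and supp: "\<And>x. K < norm x \<Longrightarrow> g x = 0"
  shows "integrable lborel g"
proof -
  have "integrable lborel (\<lambda>x. indicator (cball 0 K) x *\<^sub>R g x)"
    using cont by (intro borel_integrable_compact) (auto intro: continuous_on_subset)
  also have "(\<lambda>x. indicator (cball 0 K) x *\<^sub>R g x) = g"
    using supp by (auto simp: indicator_def fun_eq_iff)
  finally show ?thesis .
qed

lemma GDERIV_bounded_support:
  assumes der: "\<And>x. GDERIV g x :> g' x" and supp: "\<And>x. K < norm x \<Longrightarrow> g x = 0" and x: "K < norm x"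
  shows "g' x = 0"
proof -
  have "open {x::'a. K < norm x}"
    by (intro open_Collect_less continuous_intros)
  then have "((\<lambda>x. 0) has_derivative (\<lambda>h. h \<bullet> g' x)) (at x)"
    using der[of x] x supp unfolding gderiv_def by (auto intro: has_derivative_transform_within_open)
  then have "(\<lambda>h. h \<bullet> g' x) = (\<lambda>h. 0)"
    by (rule has_derivative_unique) simp
  then have "g' x \<bullet> g' x = 0"
    by metis
  then show ?thesis by simp
qed

text \<open>Translation invariance makes every difference quotient of \<open>g\<close> integrate to zero.\<close>

lemma integral_directional_derivative_eq_0:
  fixes g :: "'a::euclidean_space \<Rightarrow> real"
  assumes der: "\<And>x. GDERIV g x :> g' x" and cont: "continuous_on UNIV g'"
    and supp: "\<And>x. K < norm x \<Longrightarrow> g x = 0"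
  shows "(LINT x|lborel. g' x \<bullet> b) = 0"
proof -
  have g_cont: "continuous_on UNIV g"
    using der GDERIV_isCont continuous_at_imp_continuous_on by blast
  have "compact (g' ` cball 0 K)"
    using cont by (intro compact_continuous_image) (auto intro: continuous_on_subset)
  then obtain M where M: "0 < M" "\<And>x. x \<in> cball 0 K \<Longrightarrow> norm (g' x) \<le> M"
    using compact_imp_bounded bounded_pos by (metis imageI)
  have g'M: "norm (g' x) \<le> M" for x
    using M GDERIV_bounded_support[of g g' K x, OF der supp] by (cases "K < norm x") auto
  \<comment> \<open>A global Lipschitz constant bounds all difference quotients by
    \<open>M * norm b\<close>, which will serve for dominated convergence.\<close>
  have lip: "norm (g y - g x) \<le> M * norm (y - x)" for x y
  proof (rule differentiable_bound[of UNIV])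
    fix x :: 'a
    show "(g has_derivative (\<lambda>h. h \<bullet> g' x)) (at x within UNIV)"
      using der[of x] by (simp add: gderiv_def)
    show "onorm (\<lambda>h. h \<bullet> g' x) \<le> M"
    proof (rule onorm_bound)
      show "norm (h \<bullet> g' x) \<le> M * norm h" for h
        using Cauchy_Schwarz_ineq2[of h "g' x"] mult_left_mono[OF g'M[of x], of "norm h"]
        by (simp add: mult.commute)
    qed (use M in simp)
  qed auto
  \<comment> \<open>The steps are never zero and never exceed 1, so all the quotients
    \<open>s n\<close> vanish outside the one ball of radius \<open>K + norm b\<close>.\<close>
  define h where "h = (\<lambda>n::nat. 1 / (real n + 1))"
  define s where "s = (\<lambda>n x. (g (h n *\<^sub>R b + x) - g x) / h n)"
  have h: "0 < h n" "h n \<le> 1" for n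
    by (auto simp: h_def)
  have h_lim: "filterlim h (at 0) sequentially"
  proof (rule filterlim_atI)
    show "h \<longlonglongrightarrow> 0"
      unfolding h_def using LIMSEQ_inverse_real_of_nat by (simp add: inverse_eq_divide add.commute)
    show "\<forall>\<^sub>F n in sequentially. h n \<noteq> 0"
      using h by (simp add: less_imp_neq[symmetric] always_eventually)
  qed
  have g_int: "integrable lborel g"
    using g_cont supp by (rule integrable_continuous_bounded_support)
  have g_meas: "g \<in> borel_measurable borel"
    using g_cont by (rule borel_measurable_continuous_onI)
  have shift_int: "integrable lborel (\<lambda>x. g (c + x))" and shift: "(LINT x|lborel. g (c + x)) = (LINT x|lborel. g x)" for c
  proof -
    show "(LINT x|lborel. g (c + x)) = (LINT x|lborel. g x)"
      using integral_distr[of "(+) c" lborel borel g] g_meas lborel_distr_plus[of c] by simp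
    show "integrable lborel (\<lambda>x. g (c + x))"
      using integrable_distr_eq[of "(+) c" lborel borel g] g_meas g_int lborel_distr_plus[of c] by simp
  qed
  have "(LINT x|lborel. s n x) = 0" for n
    unfolding s_def using shift_int g_int shift by (simp add: Bochner_Integration.integral_diff)
  moreover have "(\<lambda>n. LINT x|lborel. s n x) \<longlonglongrightarrow> (LINT x|lborel. g' x \<bullet> b)"
  proof (rule integral_dominated_convergence)
    let ?w = "\<lambda>x::'a. indicator (cball 0 (K + norm b)) x *\<^sub>R (M * norm b)"
    show "(\<lambda>x. g' x \<bullet> b) \<in> borel_measurable lborel"
      using cont by (auto intro!: borel_measurable_continuous_onI continuous_intros)
    show "s n \<in> borel_measurable lborel" for n
      unfolding s_def using shift_int g_int by auto
    show "integrable lborel ?w"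
      by (intro borel_integrable_compact) auto
    have "(\<lambda>n. s n x) \<longlonglongrightarrow> g' x \<bullet> b" for x
    proof -
      have "((\<lambda>t. g (t *\<^sub>R b + x)) has_derivative (\<lambda>t. (t *\<^sub>R b) \<bullet> g' x)) (at 0)"
      proof (rule has_derivative_compose[where g = g and f = "\<lambda>t. t *\<^sub>R b + x"])
        show "((\<lambda>t. t *\<^sub>R b + x) has_derivative (\<lambda>t. t *\<^sub>R b)) (at 0)"
          by (auto intro!: derivative_eq_intros)
        show "(g has_derivative (\<lambda>h. h \<bullet> g' x)) (at (0 *\<^sub>R b + x))"
          using der[of x] by (simp add: gderiv_def)
      qed
      then have "((\<lambda>t. g (t *\<^sub>R b + x)) has_real_derivative b \<bullet> g' x) (at 0)"
        by (rule has_derivative_imp_has_field_derivative) simp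
      then have "((\<lambda>t. (g (t *\<^sub>R b + x) - g x) / t) \<longlongrightarrow> b \<bullet> g' x) (at 0)"
        by (simp add: has_field_derivative_iff)
      from filterlim_compose[OF this h_lim] show ?thesis
        by (simp add: s_def inner_commute)
    qed
    then show "AE x in lborel. (\<lambda>n. s n x) \<longlonglongrightarrow> g' x \<bullet> b"
      by simp
    have "norm (s n x) \<le> ?w x" for n x
    proof (cases "x \<in> cball 0 (K + norm b)")
      case True
      have "norm (s n x) = norm (g (h n *\<^sub>R b + x) - g x) / h n"
        using h[of n] by (simp add: s_def)
      also have "\<dots> \<le> M * norm b"
        using lip[of "h n *\<^sub>R b + x" x] h[of n] by (simp add: field_simps)
      finally show ?thesis
        using True by simp
    next
      case False
      then have x: "K + norm b < norm x" by simp
      have "norm (h n *\<^sub>R b) \<le> norm b"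
        using h[of n] by (simp add: mult_left_le_one_le)
      then have "K < norm (h n *\<^sub>R b + x)"
        using x norm_triangle_ineq4[of "h n *\<^sub>R b + x" "h n *\<^sub>R b"] by simp
      moreover have "K < norm x"
        using x norm_ge_zero[of b] by linarith
      ultimately show ?thesis
        using False by (simp add: s_def supp)
    qed
    then show "AE x in lborel. norm (s n x) \<le> ?w x" for n
      by simp
  qed
  ultimately show ?thesis
    by (simp add: LIMSEQ_const_iff)
qed

text \<open>Hardy's inequality: completing the square against the vector field
  \<open>X = k x / (|x|\<^sup>2 + \<epsilon>)\<close>, for which \<open>div X - |X|\<^sup>2 \<ge> k\<^sup>2 / (|x|\<^sup>2 + \<epsilon>)\<close>.\<close>

lemma hardy_regularised:
  fixes \<phi> :: "'a::euclidean_space \<Rightarrow> real"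
  assumes phi: "C1 \<phi>" and supp: "\<And>x. K < norm x \<Longrightarrow> \<phi> x = 0"
    and k: "2 * k = real DIM('a) - 2" "0 \<le> k" and eps: "0 < \<epsilon>"
    and V: "continuous_on UNIV V"
    and V_le: "\<And>x. norm x \<le> K \<Longrightarrow> V x * ((norm x)\<^sup>2 + \<epsilon>) \<le> k\<^sup>2"
  shows "(LINT x|lborel. V x * (\<phi> x)\<^sup>2) \<le> (LINT x|lborel. (norm (grad \<phi> x))\<^sup>2)"
proof -
  note der = C1_GDERIV[OF phi]
  have grad_cont: "continuous_on UNIV (grad \<phi>)"
    using phi by (simp add: C1_def)
  have phi_cont: "continuous_on UNIV \<phi>"
    using phi by (rule C1_continuous_on)
  have grad_supp: "grad \<phi> x = 0" if "K < norm x" for x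
    using GDERIV_bounded_support[OF der supp that] .
  define d where "d = (\<lambda>x::'a. x \<bullet> x + \<epsilon>)"
  have d: "0 < d x" for x
    using eps by (simp add: d_def add_nonneg_pos)
  have d_cont: "continuous_on UNIV d"
    unfolding d_def by (intro continuous_intros)
  \<comment> \<open>This is the gradient of the component along \<open>b\<close> of \<phi>^2 X; the
    sum \<open>G\<close> defined from it is the divergence of that field and integrates to
    zero.\<close>
  define g' where "g' = (\<lambda>b x. (2 * k * \<phi> x * (x \<bullet> b) / d x) *\<^sub>R grad \<phi> x
      + (k * (\<phi> x)\<^sup>2 / d x) *\<^sub>R b - (2 * k * (\<phi> x)\<^sup>2 * (x \<bullet> b) / (d x)\<^sup>2) *\<^sub>R x)"
  have g_der: "GDERIV (\<lambda>x. k * (\<phi> x)\<^sup>2 * (x \<bullet> b) / d x) x :> g' b x" for b x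
  proof -
    have "((\<lambda>x. x \<bullet> x + \<epsilon>) has_derivative (\<lambda>h. x \<bullet> h + h \<bullet> x + 0)) (at x)"
      by (rule has_derivative_add[OF has_derivative_inner[OF has_derivative_ident has_derivative_ident]
            has_derivative_const])
    moreover have "(\<lambda>h. x \<bullet> h + h \<bullet> x + 0) = (\<lambda>h. h \<bullet> (2 *\<^sub>R x))"
      by (simp add: fun_eq_iff inner_commute[of x])
    ultimately have d_der: "GDERIV d x :> 2 *\<^sub>R x"
      unfolding gderiv_def d_def by simp
    have "d x \<noteq> 0"
      using d[of x] by simp
    from GDERIV_mult[OF GDERIV_mult[OF GDERIV_const[of k x] GDERIV_mult[OF der[of x] der[of x]]]
        GDERIV_mult[OF GDERIV_inner_left GDERIV_inverse[OF d_der this]]]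
    show ?thesis
      unfolding gderiv_def g'_def using d[of x]
      by (simp add: inner_simps divide_inverse power2_eq_square algebra_simps)
  qed
  have g'_cont: "continuous_on UNIV (g' b)" for b
    unfolding g'_def using d
    by (intro continuous_intros phi_cont grad_cont d_cont) (auto simp: less_imp_neq[symmetric])
  have g'_supp: "g' b x = 0" if "K < norm x" for b x
    using supp[OF that] by (simp add: g'_def)
  have g'_int: "integrable lborel (\<lambda>x. g' b x \<bullet> b)" for b
    using g'_cont[of b] by (intro integrable_continuous_bounded_support[where K = K] continuous_intros)
      (auto simp: g'_supp)
  have g'_0: "(LINT x|lborel. g' b x \<bullet> b) = 0" for b
    by (rule integral_directional_derivative_eq_0[OF g_der g'_cont, where K = K]) (simp add: supp)
  define G where "G = (\<lambda>x. \<Sum>b\<in>Basis. g' b x \<bullet> b)"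
  have G_int: "integrable lborel G"
    unfolding G_def by (intro Bochner_Integration.integrable_sum g'_int)
  have G_0: "(LINT x|lborel. G x) = 0"
    unfolding G_def by (subst Bochner_Integration.integral_sum) (auto simp: g'_int g'_0)
  have G: "G x = 2 * k * \<phi> x / d x * (x \<bullet> grad \<phi> x) + real DIM('a) * k * (\<phi> x)\<^sup>2 / d x
      - 2 * k * (\<phi> x)\<^sup>2 * (x \<bullet> x) / (d x)\<^sup>2" for x
  proof -
    have "g' b x \<bullet> b = 2 * k * \<phi> x / d x * ((x \<bullet> b) * (grad \<phi> x \<bullet> b)) + k * (\<phi> x)\<^sup>2 / d x
      - 2 * k * (\<phi> x)\<^sup>2 / (d x)\<^sup>2 * ((x \<bullet> b) * (x \<bullet> b))" if "b \<in> Basis" for b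
      using that by (simp add: g'_def inner_simps inner_same_Basis)
    then have "G x = (\<Sum>b\<in>Basis. 2 * k * \<phi> x / d x * ((x \<bullet> b) * (grad \<phi> x \<bullet> b)) + k * (\<phi> x)\<^sup>2 / d x
      - 2 * k * (\<phi> x)\<^sup>2 / (d x)\<^sup>2 * ((x \<bullet> b) * (x \<bullet> b)))"
      unfolding G_def by (intro sum.cong) auto
    also have "\<dots> = 2 * k * \<phi> x / d x * (x \<bullet> grad \<phi> x) + real DIM('a) * (k * (\<phi> x)\<^sup>2 / d x)
      - 2 * k * (\<phi> x)\<^sup>2 / (d x)\<^sup>2 * (x \<bullet> x)"
      unfolding euclidean_inner[of x "grad \<phi> x"] euclidean_inner[of x x]
      by (simp add: sum.distrib sum_subtractf sum_distrib_left)
    finally show ?thesis by simp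
  qed
  have V_int: "integrable lborel (\<lambda>x. V x * (\<phi> x)\<^sup>2)"
    by (intro integrable_continuous_bounded_support[where K = K] continuous_intros V phi_cont) (simp add: supp)
  have grad_int: "integrable lborel (\<lambda>x. (norm (grad \<phi> x))\<^sup>2)"
    by (intro integrable_continuous_bounded_support[where K = K] continuous_intros grad_cont)
      (simp add: grad_supp)
  have "V x * (\<phi> x)\<^sup>2 \<le> (norm (grad \<phi> x))\<^sup>2 + G x" for x
  proof (cases "norm x \<le> K")
    case True
    let ?c = "k * \<phi> x / d x"
    have "V x \<le> k\<^sup>2 / d x"
      using V_le[OF True] d[of x] by (simp add: pos_le_divide_eq d_def power2_norm_eq_inner)
    then have "V x * (\<phi> x)\<^sup>2 \<le> k\<^sup>2 / d x * (\<phi> x)\<^sup>2"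
      by (intro mult_right_mono) auto
    also have "\<dots> \<le> (norm (grad \<phi> x + ?c *\<^sub>R x))\<^sup>2 + \<dots>"
      by simp
    also have "(norm (grad \<phi> x + ?c *\<^sub>R x))\<^sup>2
        = (norm (grad \<phi> x))\<^sup>2 + 2 * ?c * (x \<bullet> grad \<phi> x) + ?c\<^sup>2 * (x \<bullet> x)"
      unfolding power2_norm_eq_inner
      by (simp add: inner_simps inner_commute power2_eq_square)
    \<comment> \<open>The cross term is the gradient part of \<open>G\<close>. Writing
      \<open>x \<bullet> x\<close> as \<open>d x - \<epsilon>\<close> leaves one remainder, which
      has a favourable sign because \<open>k\<close> and \<epsilon> are nonnegative.\<close>
    also have "(norm (grad \<phi> x))\<^sup>2 + 2 * ?c * (x \<bullet> grad \<phi> x) + ?c\<^sup>2 * (x \<bullet> x) + k\<^sup>2 / d x * (\<phi> x)\<^sup>2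
      = (norm (grad \<phi> x))\<^sup>2 + G x - (2 + k) * k * \<epsilon> * (\<phi> x)\<^sup>2 / (d x)\<^sup>2"
    proof -
      have dim: "real DIM('a) = 2 * k + 2" and xx: "x \<bullet> x = d x - \<epsilon>"
        using k by (auto simp: d_def)
      have "?c\<^sup>2 * (x \<bullet> x) + k\<^sup>2 / d x * (\<phi> x)\<^sup>2
        = real DIM('a) * k * (\<phi> x)\<^sup>2 / d x - 2 * k * (\<phi> x)\<^sup>2 * (x \<bullet> x) / (d x)\<^sup>2
          - (2 + k) * k * \<epsilon> * (\<phi> x)\<^sup>2 / (d x)\<^sup>2"
        unfolding dim xx using d[of x] by (simp add: field_simps power2_eq_square)
      then show ?thesis
        unfolding G by simp
    qed
    also have "\<dots> \<le> (norm (grad \<phi> x))\<^sup>2 + G x"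
      using k eps by simp
    finally show ?thesis .
  next
    case False
    then show ?thesis
      by (simp add: supp G)
  qed
  then have "(LINT x|lborel. V x * (\<phi> x)\<^sup>2) \<le> (LINT x|lborel. (norm (grad \<phi> x))\<^sup>2 + G x)"
    by (intro integral_mono V_int Bochner_Integration.integrable_add grad_int G_int)
  also have "\<dots> = (LINT x|lborel. (norm (grad \<phi> x))\<^sup>2)"
    using grad_int G_int by (simp add: Bochner_Integration.integral_add G_0)
  finally show ?thesis .
qed

text \<open>The regularised inequality asks for slightly more than
  \<open>V x * (norm x)\<^sup>2 \<le> k\<^sup>2\<close>. Scaling \<open>V\<close> by
  \<open>t < 1\<close> creates the room, since \<open>V\<close> is bounded on a ball containing the
  support of \<phi>; then \<open>t\<close> tends to 1.\<close>

lemma hardy_potential: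
  fixes \<phi> :: "'a::euclidean_space \<Rightarrow> real"
  assumes phi: "C1 \<phi>" and supp: "compact (closure {x. \<phi> x \<noteq> 0})"
    and k: "2 * k = real DIM('a) - 2" "0 < k"
    and V: "continuous_on UNIV V"
    and V_le: "\<And>x. V x * (norm x)\<^sup>2 \<le> k\<^sup>2"
  shows "0 \<le> (LINT x|lborel. (norm (grad \<phi> x))\<^sup>2 - V x * (\<phi> x)\<^sup>2)"
proof -
  have "bounded {x. \<phi> x \<noteq> 0}"
    using compact_imp_bounded[OF supp] closure_subset by (rule bounded_subset)
  then obtain K where K: "\<And>x. \<phi> x \<noteq> 0 \<Longrightarrow> norm x \<le> K"
    by (auto simp: bounded_iff)
  then have K': "\<phi> x = 0" if "K < norm x" for x
    using that by (meson not_le)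
  have "compact (V ` cball 0 K)"
    using V by (intro compact_continuous_image) (auto intro: continuous_on_subset)
  then obtain M where M: "0 < M" "\<And>x. x \<in> cball 0 K \<Longrightarrow> norm (V x) \<le> M"
    using compact_imp_bounded bounded_pos by (metis imageI)
  note der = C1_GDERIV[OF phi]
  have grad_cont: "continuous_on UNIV (grad \<phi>)"
    using phi by (simp add: C1_def)
  have phi_cont: "continuous_on UNIV \<phi>"
    using phi by (rule C1_continuous_on)
  have V_int: "integrable lborel (\<lambda>x. V x * (\<phi> x)\<^sup>2)"
    by (intro integrable_continuous_bounded_support[where K = K] continuous_intros V phi_cont) (simp add: K')
  have grad_int: "integrable lborel (\<lambda>x. (norm (grad \<phi> x))\<^sup>2)"
    by (intro integrable_continuous_bounded_support[where K = K] continuous_intros grad_cont)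
      (simp add: GDERIV_bounded_support[OF der K'])
  have "t * (LINT x|lborel. V x * (\<phi> x)\<^sup>2) \<le> (LINT x|lborel. (norm (grad \<phi> x))\<^sup>2)"
    if t: "0 < t" "t < 1" for t
  proof -
    \<comment> \<open>Chosen so that \<open>M * \<epsilon>\<close> is exactly the slack
      \<open>(1 - t) * k\<^sup>2\<close>.\<close>
    define \<epsilon> where "\<epsilon> = (1 - t) * k\<^sup>2 / M"
    have eps: "0 < \<epsilon>"
      using t k M by (simp add: \<epsilon>_def)
    have "(t * V x) * ((norm x)\<^sup>2 + \<epsilon>) \<le> k\<^sup>2" if "norm x \<le> K" for x
    proof -
      have "V x * \<epsilon> \<le> M * \<epsilon>"
        using M(2)[of x] that eps by (intro mult_right_mono) auto
      also have "\<dots> = (1 - t) * k\<^sup>2"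
        using M by (simp add: \<epsilon>_def)
      finally have "t * (V x * \<epsilon>) \<le> t * ((1 - t) * k\<^sup>2)"
        using t by (intro mult_left_mono) auto
      also have "\<dots> \<le> 1 * ((1 - t) * k\<^sup>2)"
        using t by (intro mult_right_mono) auto
      finally have "t * (V x * \<epsilon>) \<le> (1 - t) * k\<^sup>2"
        by simp
      moreover have "t * (V x * (norm x)\<^sup>2) \<le> t * k\<^sup>2"
        using t V_le[of x] by (intro mult_left_mono) auto
      ultimately show ?thesis
        by (simp add: algebra_simps)
    qed
    then have "(LINT x|lborel. (t * V x) * (\<phi> x)\<^sup>2) \<le> (LINT x|lborel. (norm (grad \<phi> x))\<^sup>2)"
      using k eps by (intro hardy_regularised[where \<epsilon> = \<epsilon>, OF phi K'] continuous_intros V) auto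
    then show ?thesis
      by (simp add: mult.assoc)
  qed
  then have "(LINT x|lborel. V x * (\<phi> x)\<^sup>2) \<le> (LINT x|lborel. (norm (grad \<phi> x))\<^sup>2)"
    by (rule field_le_mult_one_interval)
  then show ?thesis
    using V_int grad_int by simp
qed

section \<open>Regularity and stability of radial solutions\<close>

lemma filterlim_norm_at_right_0: "filterlim norm (at_right 0) (at (0::'a::real_normed_vector))"
  unfolding filterlim_at by (auto simp: eventually_at_filter intro: tendsto_norm_zero tendsto_ident_at)

text \<open>Since the norm approaches 0 only from the right, a one-sided limit of the profile
  suffices at the origin.\<close>

lemma continuous_on_radial:
  fixes g :: "real \<Rightarrow> real"
  assumes "\<And>r. 0 < r \<Longrightarrow> isCont g r" and "(g \<longlongrightarrow> g 0) (at_right 0)"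
  shows "continuous_on UNIV (\<lambda>x::'a::real_normed_vector. g (norm x))"
proof (intro continuous_at_imp_continuous_on ballI)
  fix x :: 'a
  show "isCont (\<lambda>x. g (norm x)) x"
  proof (cases "x = 0")
    case True
    then show ?thesis
      using filterlim_compose[OF assms(2) filterlim_norm_at_right_0] by (simp add: isCont_def)
  next
    case False
    then show ?thesis
      using assms(1)[of "norm x"] by (intro continuous_intros isCont_o2[of x norm g]) auto
  qed
qed

text \<open>The gradient of \<open>u(|x|)\<close> is \<open>p(|x|) x\<close>, where \<open>p r = u'(r) / r\<close> extends continuously to
  \<open>p 0 = - f \<alpha> / N\<close>; its Jacobian \<open>p(r) I + r p'(r) (x/r) (x/r)\<^sup>T\<close> is continuous at the origin since
  \<open>r p'(r) = - N u'(r) / r - f(u(r))\<close> vanishes there.\<close>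

lemma radial_solution_entire:
  fixes f u :: "real \<Rightarrow> real"
  assumes f: "\<And>x. isCont f x" and u: "radial_solution N f \<alpha> u" and N: "N = DIM('a::euclidean_space)"
  shows "entire_solution f (\<lambda>x::'a. u (norm x))"
proof -
  have N0: "0 < N"
    using N by simp
  define p where "p = (\<lambda>r. if r = 0 then - f \<alpha> / real N else deriv u r / r)"
  define m where "m = (\<lambda>r. - real N * p r - f (u r))"
  define v where "v = (\<lambda>x::'a. u (norm x))"
  \<comment> \<open>\<open>H b\<close> is the candidate gradient of the component of
    \<open>grad v\<close> along \<open>b\<close>. Since \<open>sgn 0 = 0\<close>, the formula also
    gives the right value \<open>p 0 *\<^sub>R b\<close> at the origin.\<close>
  define H where "H = (\<lambda>(b::'a) x. p (norm x) *\<^sub>R b + (m (norm x) * (sgn x \<bullet> b)) *\<^sub>R sgn x)"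
  have p_der: "(p has_real_derivative m r / r) (at r)" if r: "0 < r" for r
  proof -
    have "((\<lambda>r. deriv u r / r) has_real_derivative (deriv (deriv u) r * r - deriv u r * 1) / (r * r)) (at r)"
      using r by (intro DERIV_divide radial_solution_DERIV2[OF u] DERIV_ident) auto
    moreover have "(deriv (deriv u) r * r - deriv u r * 1) / (r * r) = m r / r"
      unfolding radial_solution_ode[OF u r] m_def p_def using r by (simp add: field_simps)
    ultimately have "((\<lambda>r. deriv u r / r) has_real_derivative m r / r) (at r)"
      by simp
    then show ?thesis
      by (rule has_field_derivative_transform_within_open[of _ _ _ "{0<..}"]) (use r in \<open>auto simp: p_def\<close>)
  qed
  have p_lim: "(p \<longlongrightarrow> p 0) (at_right 0)"
  proof (rule Lim_transform_eventually)
    show "((\<lambda>r. deriv u r / r) \<longlongrightarrow> p 0) (at_right 0)"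
      using radial_solution_slope[OF u f N0] by (simp add: p_def)
    show "\<forall>\<^sub>F r in at_right 0. deriv u r / r = p r"
      by (auto simp: p_def eventually_at_filter)
  qed
  have u_lim: "(u \<longlongrightarrow> u 0) (at_right 0)"
    using radial_solution_tendsto_0[OF u] radial_solution_0[OF u] by simp
  have m_lim: "(m \<longlongrightarrow> m 0) (at_right 0)"
    unfolding m_def by (intro tendsto_intros p_lim isCont_tendsto_compose[OF f] u_lim)
  have m0: "m 0 = 0"
    using N0 by (simp add: m_def p_def radial_solution_0[OF u])
  have p_cont: "continuous_on UNIV (\<lambda>x::'a. p (norm x))"
    using p_der p_lim DERIV_isCont by (intro continuous_on_radial) blast+
  have "isCont m r" if "0 < r" for r
    unfolding m_def
    using that DERIV_isCont[OF p_der] DERIV_isCont[OF radial_solution_DERIV[OF u]] f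
    by (intro continuous_intros isCont_o2[of r u f]) auto
  then have m_cont: "continuous_on UNIV (\<lambda>x::'a. m (norm x))"
    using m_lim by (rule continuous_on_radial)
  have v_der: "GDERIV v x :> p (norm x) *\<^sub>R x" for x
  proof (cases "x = 0")
    case False
    then have "GDERIV (\<lambda>x. u (norm x)) x :> deriv u (norm x) *\<^sub>R sgn x"
      by (intro GDERIV_DERIV_compose GDERIV_norm radial_solution_DERIV[OF u]) auto
    then show ?thesis
      using False by (simp add: v_def p_def sgn_div_norm divide_inverse)
  next
    case True
    have "((\<lambda>h::'a. \<bar>(u (norm h) - \<alpha>) / norm h\<bar>) \<longlongrightarrow> 0) (at 0)"
      using tendsto_rabs_zero[OF filterlim_compose[OF radial_solution_quotient[OF u] filterlim_norm_at_right_0]] .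
    then have "((\<lambda>x. u (norm x)) has_derivative (\<lambda>h. 0)) (at (0::'a))"
      by (simp add: has_derivative_at radial_solution_0[OF u] abs_divide)
    then show ?thesis
      using True by (simp add: gderiv_def v_def)
  qed
  have H_der: "GDERIV (\<lambda>x. p (norm x) * (x \<bullet> b)) x :> H b x" for b x
  proof (cases "x = 0")
    case False
    have "GDERIV (\<lambda>x. p (norm x)) x :> (m (norm x) / norm x) *\<^sub>R sgn x"
      using False by (intro GDERIV_DERIV_compose GDERIV_norm p_der) auto
    from GDERIV_mult[OF this GDERIV_inner_left] show ?thesis
      by (simp add: H_def sgn_div_norm divide_inverse mult_ac)
  next
    case True
    \<comment> \<open>Continuity of \<open>p\<close> at 0 is enough here, because the other factor
      \<open>h \<bullet> b\<close> is already of first order in \<open>h\<close>.\<close>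
    have "((\<lambda>h::'a. \<bar>p (norm h) - p 0\<bar> * norm b) \<longlongrightarrow> \<bar>p 0 - p 0\<bar> * norm b) (at 0)"
      by (intro tendsto_intros filterlim_compose[OF p_lim filterlim_norm_at_right_0])
    then have lim: "((\<lambda>h::'a. \<bar>p (norm h) - p 0\<bar> * norm b) \<longlongrightarrow> 0) (at 0)"
      by simp
    have "((\<lambda>h::'a. norm (p (norm h) * (h \<bullet> b) - h \<bullet> (p 0 *\<^sub>R b)) / norm h) \<longlongrightarrow> 0) (at 0)"
    proof (rule Lim_null_comparison[OF _ lim], rule always_eventually, rule allI)
      fix h :: 'a
      have "norm (p (norm h) * (h \<bullet> b) - h \<bullet> (p 0 *\<^sub>R b)) = \<bar>p (norm h) - p 0\<bar> * \<bar>h \<bullet> b\<bar>"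
        by (simp add: abs_mult[symmetric] algebra_simps)
      also have "\<dots> \<le> \<bar>p (norm h) - p 0\<bar> * (norm h * norm b)"
        by (intro mult_left_mono Cauchy_Schwarz_ineq2) simp
      finally show "norm (norm (p (norm h) * (h \<bullet> b) - h \<bullet> (p 0 *\<^sub>R b)) / norm h) \<le> \<bar>p (norm h) - p 0\<bar> * norm b"
        by (cases "h = 0") (simp_all add: divide_le_eq mult_ac)
    qed
    then have "((\<lambda>x. p (norm x) * (x \<bullet> b)) has_derivative (\<lambda>h. h \<bullet> (p 0 *\<^sub>R b))) (at (0::'a))"
      by (simp add: has_derivative_at bounded_linear_inner_left del: inner_scaleR_right)
    then show ?thesis
      using True by (simp add: gderiv_def H_def)
  qed
  have H_cont: "continuous_on UNIV (H b)" for b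
  proof -
    have "isCont (\<lambda>x::'a. (m (norm x) * (sgn x \<bullet> b)) *\<^sub>R sgn x) x" for x
    proof (cases "x = 0")
      case False
      moreover have "isCont (\<lambda>x::'a. m (norm x)) x"
        using m_cont by (simp add: continuous_on_eq_continuous_at)
      ultimately show ?thesis
        by (intro continuous_intros) auto
    next
      case True
      \<comment> \<open>\<open>sgn\<close> jumps at the origin but is bounded, and the factor
        \<open>m\<close> tends to 0.\<close>
      have "((\<lambda>x::'a. \<bar>m (norm x)\<bar> * norm b) \<longlongrightarrow> \<bar>m 0\<bar> * norm b) (at 0)"
        by (intro tendsto_intros filterlim_compose[OF m_lim filterlim_norm_at_right_0])
      then have lim: "((\<lambda>x::'a. \<bar>m (norm x)\<bar> * norm b) \<longlongrightarrow> 0) (at 0)"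
        by (simp add: m0)
      have "((\<lambda>x::'a. (m (norm x) * (sgn x \<bullet> b)) *\<^sub>R sgn x) \<longlongrightarrow> 0) (at 0)"
      proof (rule Lim_null_comparison[OF _ lim], rule always_eventually, rule allI)
        fix x :: 'a
        have "\<bar>sgn x \<bullet> b\<bar> * norm (sgn x) \<le> norm b * 1"
          using Cauchy_Schwarz_ineq2[of "sgn x" b] by (intro mult_mono) (auto simp: norm_sgn split: if_splits)
        then have "\<bar>m (norm x)\<bar> * (\<bar>sgn x \<bullet> b\<bar> * norm (sgn x)) \<le> \<bar>m (norm x)\<bar> * norm b"
          by (intro mult_left_mono) auto
        then show "norm ((m (norm x) * (sgn x \<bullet> b)) *\<^sub>R sgn x) \<le> \<bar>m (norm x)\<bar> * norm b"
          by (simp add: abs_mult mult.assoc)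
      qed
      with True show ?thesis
        by (simp add: isCont_def)
    qed
    then show ?thesis
      unfolding H_def
      by (intro continuous_on_add continuous_on_scaleR p_cont continuous_on_const continuous_at_imp_continuous_on) auto
  qed
  have grad_v: "grad v = (\<lambda>x. p (norm x) *\<^sub>R x)"
    using grad_eqI[OF v_der] by blast
  have "C1 v"
    using v_der by (rule C1I) (intro continuous_intros p_cont)
  moreover have "C1 (\<lambda>x. grad v x \<bullet> b)" for b
    using C1I[OF H_der H_cont, of b] by (simp add: grad_v)
  moreover have "laplacian v x + f (v x) = 0" for x
  proof -
    have "laplacian v x = (\<Sum>b\<in>Basis. H b x \<bullet> b)"
      unfolding laplacian_def grad_v using grad_eqI[OF H_der] by (intro sum.cong) auto
    also have "\<dots> = (\<Sum>b\<in>Basis. p (norm x) + m (norm x) * ((sgn x \<bullet> b) * (sgn x \<bullet> b)))"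
      by (intro sum.cong) (auto simp: H_def inner_simps inner_same_Basis)
    also have "\<dots> = real N * p (norm x) + m (norm x) * (sgn x \<bullet> sgn x)"
      unfolding euclidean_inner[of "sgn x" "sgn x"] by (simp add: sum.distrib sum_distrib_left N)
    \<comment> \<open>For nonzero \<open>x\<close> the vector \<open>sgn x\<close> has norm 1; at
      the origin both terms with \<open>m\<close> vanish by \<open>m0\<close>.\<close>
    also have "\<dots> = real N * p (norm x) + m (norm x)"
      by (simp add: dot_square_norm norm_sgn m0)
    finally show ?thesis
      by (simp add: m_def v_def)
  qed
  ultimately show ?thesis
    unfolding entire_solution_def C2_def v_def by blast
qed

lemma radial_solution_stable:
  fixes f u :: "real \<Rightarrow> real"
  assumes f: "standing_assumptions f" and u: "radial_solution N f \<alpha> u"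
    and N: "N = DIM('a::euclidean_space)" "2 < N"
    and bound: "\<And>r. 0 < r \<Longrightarrow> r\<^sup>2 * deriv f (u r) \<le> ((real N - 2) / 2)\<^sup>2"
  shows "stable_solution f (\<lambda>x::'a. u (norm x))"
  unfolding stable_solution_def
proof (intro conjI allI impI)
  show "entire_solution f (\<lambda>x::'a. u (norm x))"
    using standing_isCont[OF f] u N(1) by (rule radial_solution_entire)
  fix \<phi> :: "'a \<Rightarrow> real"
  assume phi: "C1 \<phi> \<and> compact (closure {x. \<phi> x \<noteq> 0})"
  show "0 \<le> (LINT x|lborel. (norm (grad \<phi> x))\<^sup>2 - deriv f (u (norm x)) * (\<phi> x)\<^sup>2)"
  proof (rule hardy_potential[where k = "(real N - 2) / 2"])
    have "continuous_on UNIV (\<lambda>x::'a. u (norm x))"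
      using DERIV_isCont[OF radial_solution_DERIV[OF u]] radial_solution_tendsto_0[OF u]
        radial_solution_0[OF u] by (intro continuous_on_radial) auto
    then show "continuous_on UNIV (\<lambda>x::'a. deriv f (u (norm x)))"
      using continuous_on_compose2[OF standing_continuous_deriv[OF f]] by blast
    show "deriv f (u (norm x)) * (norm x)\<^sup>2 \<le> ((real N - 2) / 2)\<^sup>2" for x :: 'a
      using bound[of "norm x"] by (cases "x = 0") (auto simp: mult.commute)
  qed (use phi N in auto)
qed

theorem theorem1p2:
  fixes f :: "real \<Rightarrow> real" and u :: "real \<Rightarrow> real \<Rightarrow> real"
    and N :: nat and q1 q2 :: real and l :: ereal
  assumes "N = CARD('n::finite)" and "N \<ge> 11"
    and "standing_assumptions f"
    and "\<And>\<alpha>. \<alpha> > 0 \<Longrightarrow> radial_solution N f \<alpha> (\<lambda>r. u r \<alpha>)"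
    and "q1 \<le> q2" and "0 < l"
    and "1 \<le> q1" and "q1 \<le> q_JL N"
    and "\<And>w::real. 0 < w \<Longrightarrow> ereal w < l \<Longrightarrow>
           q1 \<le> deriv f w * tail_integral f w \<and> deriv f w * tail_integral f w \<le> q2"
    and "q2 * (2 * real N - 4 * q1) \<le> (real N - 2)\<^sup>2 / 4"
  shows "(\<forall>\<alpha>. 0 < \<alpha> \<and> ereal \<alpha> < l \<longrightarrow>
            stable_solution f (\<lambda>x::real^'n. u (norm x) \<alpha>)) \<and>
         ((\<forall>w>0. q1 \<le> deriv f w * tail_integral f w \<and> deriv f w * tail_integral f w \<le> q2) \<longrightarrow>
            (\<forall>\<alpha>>0. stable_solution f (\<lambda>x::real^'n. u (norm x) \<alpha>)) \<and>
            (\<forall>r>0. strict_mono_on {0<..} (\<lambda>\<alpha>. u r \<alpha>)))"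
proof -
  have N: "2 < N" "N = DIM(real^'n)"
    using assms(1,2) by auto
  have q1: "0 < q1"
    using assms(7) by simp
  \<comment> \<open>The bound appears twice: first conditional on positivity below \<open>R\<close>,
    the form that yields positivity everywhere, and then unconditionally as
    \<open>bound'\<close>.\<close>
  have bound: "r\<^sup>2 * deriv f (u r \<alpha>) \<le> ((real N - 2) / 2)\<^sup>2"
    if alpha: "0 < \<alpha>"
      and Q: "\<And>w. 0 < w \<Longrightarrow> w \<le> \<alpha> \<Longrightarrow>
         q1 \<le> deriv f w * tail_integral f w \<and> deriv f w * tail_integral f w \<le> q2"
      and pos: "\<And>s. 0 \<le> s \<Longrightarrow> s < R \<Longrightarrow> 0 < u s \<alpha>"
      and r: "0 < r" "r < R" for \<alpha> r R
    using deriv_radial_upper_bound[OF assms(3) assms(4)[OF alpha] N(1) alpha q1 assms(8) Q assms(10) pos r] .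
  have pos: "0 < u r \<alpha>"
    if alpha: "0 < \<alpha>"
      and Q: "\<And>w. 0 < w \<Longrightarrow> w \<le> \<alpha> \<Longrightarrow>
         q1 \<le> deriv f w * tail_integral f w \<and> deriv f w * tail_integral f w \<le> q2"
      and r: "0 \<le> r" for \<alpha> r
    using radial_solution_pos[OF assms(3) assms(4)[OF alpha] N(1) alpha bound[OF alpha Q] r] .
  have bound': "r\<^sup>2 * deriv f (u r \<alpha>) \<le> ((real N - 2) / 2)\<^sup>2"
    if alpha: "0 < \<alpha>"
      and Q: "\<And>w. 0 < w \<Longrightarrow> w \<le> \<alpha> \<Longrightarrow>
         q1 \<le> deriv f w * tail_integral f w \<and> deriv f w * tail_integral f w \<le> q2"
      and r: "0 < r" for \<alpha> r
    using bound[OF alpha Q pos[OF alpha Q] r, of "r + 1"] by simp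
  have stable: "stable_solution f (\<lambda>x::real^'n. u (norm x) \<alpha>)"
    if alpha: "0 < \<alpha>"
      and Q: "\<And>w. 0 < w \<Longrightarrow> w \<le> \<alpha> \<Longrightarrow>
         q1 \<le> deriv f w * tail_integral f w \<and> deriv f w * tail_integral f w \<le> q2" for \<alpha>
    using radial_solution_stable[OF assms(3) assms(4)[OF alpha] N(2,1) bound'[OF alpha Q]] .
  show ?thesis
  proof (intro conjI allI impI)
    fix \<alpha> assume "0 < \<alpha> \<and> ereal \<alpha> < l"
    then show "stable_solution f (\<lambda>x::real^'n. u (norm x) \<alpha>)"
      \<comment> \<open>The solution takes no value above \<alpha>, so only arguments up to
        \<alpha>, all below \<open>l\<close>, have to be checked.\<close>
      by (intro stable assms(9)) (auto intro: le_less_trans[of _ "ereal \<alpha>"])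
  next
    assume Q: "\<forall>w>0. q1 \<le> deriv f w * tail_integral f w \<and> deriv f w * tail_integral f w \<le> q2"
    show "stable_solution f (\<lambda>x::real^'n. u (norm x) \<alpha>)" if "0 < \<alpha>" for \<alpha>
      using that Q by (intro stable) auto
    show "strict_mono_on {0<..} (u r)" if r: "0 < r" for r
    proof (rule strict_mono_onI)
      fix \<alpha> \<beta> :: real assume "\<alpha> \<in> {0<..}" "\<beta> \<in> {0<..}" and less: "\<alpha> < \<beta>"
      then have ab: "0 < \<alpha>" "0 < \<beta>" by auto
      show "u r \<alpha> < u r \<beta>"
        by (rule radial_solutions_ordered[OF assms(3) N(1) assms(4)[OF ab(1)] assms(4)[OF ab(2)] less])
          (use ab Q r in \<open>auto intro!: pos bound'\<close>)
    qed
  qed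
qed

end
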